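(* Let $n\ge 1$ be an integer and $D_M>0$. There exist finite constants $C_1,C_2$, depending only on $n$ and $D_M$, such that for every increasing and convex function $M:[0,\infty)\to[0,\infty)$ with $M(0)=0$ and $M(ax)\le a^{D_M}M(x)$ for all $a\ge 1$, $x\ge 0$, the one-dimensional inequality $$\int_0^\infty M(r|v(r)|)\,d\mu_n(r)\le C_1\int_0^\infty M(|v(r)|)\,d\mu_n(r)+C_2\int_0^\infty M(|v'(r)|)\,d\mu_n(r)$$ holds for every continuous, piecewise $C^1$ function $v:[0,\infty)\to\mathbb{R}$, and, with the same constants $C_1,C_2$, for every $u\in C^1_0(\mathbb{R}^n)$, $$\int_{\mathbb{R}^n} M(|x|\,|u(x)|)\,d\gamma_n(x)\le C_1\int_{\mathbb{R}^n}M(|u(x)|)\,d\gamma_n(x)+C_2\int_{\mathbb{R}^n}M(|\nabla u(x)|)\,d\gamma_n(x).$$ When such an $M$ is moreover an $N$-function, then also there exists a constant $C>0$ such that for every $u\in C^1_0(\mathbb{R}^n)$, $$\|u(x)\,x\|_{L^M(\mathbb{R}^n,\gamma_n)}\le C\left(\|u\|_{L^M(\mathbb{R}^n,\gamma_n)}+\|\nabla u\|_{L^M(\mathbb{R}^n,\gamma_n)}\right).$$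
   Context: $\mu_n$ is the measure on $[0,\infty)$ given by $d\mu_n(r)=r^{n-1}e^{-r^2/2}\,dr$, and $\gamma_n$ is the measure on $\mathbb{R}^n$ given by $d\gamma_n(x)=e^{-|x|^2/2}\,dx$. Integrals of nonnegative functions take values in $[0,+\infty]$. $C^1_0(\mathbb{R}^n)$ denotes the compactly supported real-valued $C^1$ functions on $\mathbb{R}^n$. A function $M:[0,\infty)\to[0,\infty)$ is an $N$-function if it is convex, $M(0)=0$, $\lim_{r\to0^+}M(r)/r=0$ and $\lim_{r\to\infty}M(r)/r=\infty$. For an $N$-function $M$ and a measure $\mu$ on $\mathbb{R}^n$, the Luxemburg norm is $\|f\|_{L^M(\mathbb{R}^n,\mu)}=\inf\{K>0:\int_{\mathbb{R}^n} M(|f(x)|/K)\,d\mu(x)\le 1\}$, where for vector-valued $f$ the symbol $|f(x)|$ is the Euclidean norm. *)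

theory Defs
  imports "HOL-Analysis.Analysis"
begin

(* mu n is carried by the half-line; as a measure on the type real it is 0 on the negative reals. *)
definition mu :: "nat \<Rightarrow> real measure" where
  "mu n = density lborel (\<lambda>r. ennreal (indicator {0..} r * r ^ (n - 1) * exp (- r\<^sup>2 / 2)))"

(* Not normalised to a probability measure. *)
definition gam :: "(real ^ 'n) measure" where
  "gam = density lborel (\<lambda>x. ennreal (exp (- (norm x)\<^sup>2 / 2)))"

definition gradient :: "('a::euclidean_space \<Rightarrow> real) \<Rightarrow> 'a \<Rightarrow> 'a" where
  "gradient u x = (THE g. GDERIV u x :> g)"

lemma gradient_eqI:
  assumes "GDERIV u x :> g"
  shows "gradient u x = g"
  unfolding gradient_def
proof (rule the_equality)
  show "GDERIV u x :> g" by (fact assms)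
next
  fix h assume "GDERIV u x :> h"
  then have "(\<lambda>y. y \<bullet> h) = (\<lambda>y. y \<bullet> g)"
    using assms unfolding gderiv_def by (rule has_derivative_unique)
  then show "h = g"
    by (metis euclidean_eqI inner_commute)
qed

definition C1_compact_support :: "('a::euclidean_space \<Rightarrow> real) \<Rightarrow> bool" where
  "C1_compact_support u \<longleftrightarrow>
     (\<forall>x. \<exists>g. GDERIV u x :> g) \<and> continuous_on UNIV (gradient u) \<and>
     compact (closure {x. u x \<noteq> 0})"

(* Functions on the closed half-line are functions on the type real whose values at negative
   arguments are irrelevant.  Piecewise C1 on the half-line means piecewise C1, with finitely
   many exceptional points, on every bounded initial segment; continuity is part of
   piecewise_C1_differentiable_on. *)
definition piecewise_C1_halfline :: "(real \<Rightarrow> real) \<Rightarrow> bool" where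
  "piecewise_C1_halfline v \<longleftrightarrow> (\<forall>R>0. v piecewise_C1_differentiable_on {0..R})"

definition growth_convex :: "real \<Rightarrow> (real \<Rightarrow> real) \<Rightarrow> bool" where
  "growth_convex D M \<longleftrightarrow>
     (\<forall>x\<ge>0. M x \<ge> 0) \<and> mono_on {0..} M \<and> convex_on {0..} M \<and> M 0 = 0 \<and>
     (\<forall>a\<ge>1. \<forall>x\<ge>0. M (a * x) \<le> a powr D * M x)"

definition N_function :: "(real \<Rightarrow> real) \<Rightarrow> bool" where
  "N_function M \<longleftrightarrow>
     (\<forall>x\<ge>0. M x \<ge> 0) \<and> convex_on {0..} M \<and> M 0 = 0 \<and>
     ((\<lambda>r. M r / r) \<longlongrightarrow> 0) (at_right 0) \<and> filterlim (\<lambda>r. M r / r) at_top at_top"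

(* Valued in ennreal, so that the infimum of the empty set is infinity. *)
definition luxemburg_norm ::
  "(real \<Rightarrow> real) \<Rightarrow> 'a measure \<Rightarrow> ('a \<Rightarrow> 'b::euclidean_space) \<Rightarrow> ennreal" where
  "luxemburg_norm M N f =
     (INF K \<in> {K::real. K > 0 \<and> (\<integral>\<^sup>+ x. ennreal (M (norm (f x) / K)) \<partial>N) \<le> 1}. ennreal K)"

end

theory Submission
  imports Defs
begin

text \<open>
  The weight \<open>W r = r ^ (n - 1) * exp (- r\<^sup>2 / 2)\<close> satisfies \<open>W' = ((n - 1) / r - r) * W\<close>,
  so for large \<open>r\<close> a factor \<open>r * W\<close> is, up to a lower order term, minus the derivative of \<open>W\<close>.
  Integration by parts therefore trades a factor \<open>r\<close> under the integral for a derivative of the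
  integrand.  Applied to the function \<open>M (r * w)\<close> multiplied by \<open>h r = r / (1 + r\<^sup>2)\<close>, this
  produces \<open>- M (r * w)\<close> as main term.  The errors are \<open>M (r * w) / (1 + r\<^sup>2)\<close>, which for large \<open>r\<close> is
  absorbed by the main term and for bounded \<open>r\<close> is at most a multiple of \<open>M w\<close> by the growth
  condition, and a term with \<open>w'\<close>, which a Young type inequality splits into a small multiple of
  \<open>M (r * w)\<close> and a large multiple of \<open>M \<bar>w'\<bar>\<close>.  The boundary term at \<open>0\<close> vanishes with
  the factor \<open>h\<close>, and the one at the right end has the favourable sign.

  Three regularisations make this rigorous.  The function \<open>M\<close> need not be differentiable; it is
  replaced by its mean over \<open>[0, x]\<close>, which is comparable to \<open>M\<close> and differentiable for \<open>x > 0\<close>.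
  The function \<open>\<bar>v\<bar>\<close> need not be differentiable at zeros of \<open>v\<close>; it is replaced by
  \<open>sqrt (v\<^sup>2 + \<delta>\<^sup>2)\<close>, and \<open>\<delta>\<close> tends to \<open>0\<close> at the end.  Finally, the integrals are taken over
  \<open>[0, R]\<close> first.  The pointwise estimate is \<open>ray_potential_deriv_le\<close>; its integrated forms are
  \<open>interval_inequality\<close> and \<open>halfline_inequality\<close>.

  In dimension \<open>n\<close> the one-dimensional inequality is applied to \<open>u\<close> on every ray from the origin,
  where the derivative along the ray is at most the length of the gradient.  Polar coordinates
  enter only in an averaged form, \<open>nn_integral_gam_polar\<close>: the sphere of directions is replaced by
  the shell \<open>1 \<le> norm y \<le> 2\<close>, and the formula is a consequence of Tonelli's theorem and of the
  behaviour of Lebesgue measure under dilations.  The constants are the same because each ray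
  contributes its own inequality.

  The norm inequality follows by homogeneity: if \<open>a\<close> and \<open>b\<close> are admissible for \<open>u\<close> and its
  gradient, then the modular of \<open>norm x * u x / (a + b)\<close> is at most \<open>C1 + C2\<close>, and convexity turns a
  bound on the modular into a bound on the norm.
\<close>

section \<open>Convex functions of power growth\<close>

lemma
  assumes "growth_convex D M"
  shows growth_convex_nonneg: "0 \<le> x \<Longrightarrow> 0 \<le> M x"
    and growth_convex_mono: "0 \<le> x \<Longrightarrow> x \<le> y \<Longrightarrow> M x \<le> M y"
    and growth_convex_zero: "M 0 = 0"
    and growth_convex_scale_up: "1 \<le> a \<Longrightarrow> 0 \<le> x \<Longrightarrow> M (a * x) \<le> a powr D * M x"
    and growth_convex_scale_down: "0 \<le> c \<Longrightarrow> c \<le> 1 \<Longrightarrow> 0 \<le> x \<Longrightarrow> M (c * x) \<le> c * M x"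
proof -
  show "0 \<le> x \<Longrightarrow> 0 \<le> M x" and "0 \<le> x \<Longrightarrow> x \<le> y \<Longrightarrow> M x \<le> M y" and z: "M 0 = 0"
    and "1 \<le> a \<Longrightarrow> 0 \<le> x \<Longrightarrow> M (a * x) \<le> a powr D * M x"
    using assms by (auto simp: growth_convex_def mono_on_def)
  show "M (c * x) \<le> c * M x" if "0 \<le> c" "c \<le> 1" "0 \<le> x"
  proof -
    have "convex_on {0..} M" using assms by (simp add: growth_convex_def)
    from convex_onD[OF this, of c 0 x] show ?thesis using that z by simp
  qed
qed

lemma growth_convex_slope_mono:
  assumes "growth_convex D M" "0 < x" "x \<le> y"
  shows "M x / x \<le> M y / y"
  using growth_convex_scale_down[OF assms(1), of "x / y" y] assms(2,3)
  by (simp add: field_simps)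

lemma growth_convex_quasi_subadditive:
  assumes g: "growth_convex D M" and ab: "0 \<le> a" "0 \<le> b"
  shows "M (a + b) \<le> 2 powr D * (M a + M b)"
proof -
  have c: "convex_on {0..} M" using g by (simp add: growth_convex_def)
  have "M (a + b) \<le> (1/2) * M (2 * a) + (1/2) * M (2 * b)"
    using convex_onD[OF c, of "1/2" "2 * a" "2 * b"] ab by simp
  also have "\<dots> \<le> M (2 * a) + M (2 * b)"
    using growth_convex_nonneg[OF g, of "2 * a"] growth_convex_nonneg[OF g, of "2 * b"] ab by simp
  also have "\<dots> \<le> 2 powr D * M a + 2 powr D * M b"
    using growth_convex_scale_up[OF g, of 2 a] growth_convex_scale_up[OF g, of 2 b] ab by simp
  finally show ?thesis by (simp add: distrib_left)
qed

text \<open>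
  Convexity gives continuity in the interior of the half-line; at the end point \<open>0\<close> it has to be
  extracted from \<open>0 \<le> M x \<le> x * M 1\<close>.
\<close>

lemma growth_convex_continuous:
  assumes g: "growth_convex D M"
  shows "continuous_on {0..} M"
proof -
  have c: "convex_on {0<..} M"
    using g convex_on_subset[of "{0..}" M "{0<..}"]
    by (auto simp: growth_convex_def subset_iff)
  have pos: "isCont M x" if "x > 0" for x
    using convex_on_continuous[OF _ c] that by (simp add: continuous_on_eq_continuous_at)
  have zero: "(M \<longlongrightarrow> 0) (at 0 within {0..})"
  proof (rule tendsto_sandwich[where f = "\<lambda>_. 0" and h = "\<lambda>x. x * M 1"])
    show "\<forall>\<^sub>F x in at 0 within {0..}. 0 \<le> M x"
      using growth_convex_nonneg[OF g] by (auto simp: eventually_at_filter)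
    show "\<forall>\<^sub>F x in at 0 within {0..}. M x \<le> x * M 1"
      unfolding eventually_at
      using growth_convex_scale_down[OF g, of _ 1] by (intro exI[of _ 1]) auto
    show "((\<lambda>x. x * M 1) \<longlongrightarrow> 0) (at 0 within {0..})"
      by (auto intro!: tendsto_eq_intros)
  qed auto
  show ?thesis
    unfolding continuous_on_def
  proof
    fix x :: real assume "x \<in> {0..}"
    then consider "x = 0" | "x > 0" by fastforce
    then show "(M \<longlongrightarrow> M x) (at x within {0..})"
    proof cases
      case 1 then show ?thesis using zero growth_convex_zero[OF g] by simp
    next
      case 2 then show ?thesis using pos[of x] by (auto simp: isCont_def intro: tendsto_within_subset)
    qed
  qed
qed

text \<open>
  The values of \<open>M\<close> at negative arguments are arbitrary, so \<open>M\<close> itself may fail to be measurable;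
  only its composition with nonnegative functions is.
\<close>

lemma growth_convex_measurable:
  assumes g: "growth_convex D M" and f: "f \<in> borel_measurable N" and "\<And>x. 0 \<le> f x"
  shows "(\<lambda>x. M (f x)) \<in> borel_measurable N"
proof -
  have "mono (\<lambda>x. M (max 0 x))"
    by (intro monoI growth_convex_mono[OF g]) auto
  then have "(\<lambda>x. M (max 0 x)) \<in> borel_measurable borel"
    by (rule borel_measurable_mono)
  from measurable_compose[OF f this] show ?thesis
    using assms(3) by (simp add: max_def)
qed

text \<open>
  The quotient \<open>M y / y\<close> plays the role of the derivative of \<open>M\<close> at \<open>y\<close>.  Either \<open>b\<close> is a small
  multiple of \<open>y\<close>, and the first term on the right suffices, or \<open>y \<le> b / e\<close>, and monotonicity of
  the quotient moves it to the point \<open>b / e\<close>.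
\<close>

lemma growth_convex_young:
  assumes g: "growth_convex D M" and "0 < y" "0 \<le> b" and e: "0 < e"
  shows "M y / y * b \<le> e * M y + e * M (b / e)"
proof (cases "b \<le> e * y")
  case True
  then have "M y / y * b \<le> M y / y * (e * y)"
    using growth_convex_nonneg[OF g, of y] assms by (intro mult_left_mono) auto
  also have "\<dots> = e * M y" using assms by simp
  also have "\<dots> \<le> e * M y + e * M (b / e)"
    using growth_convex_nonneg[OF g, of "b / e"] assms by simp
  finally show ?thesis .
next
  case False
  then have l: "y \<le> b / e" and "b > 0"
    using e \<open>0 < y\<close> by (auto simp: field_simps) (smt (verit) mult_pos_pos)
  then have "M y / y * b \<le> M (b / e) / (b / e) * b"
    using growth_convex_slope_mono[OF g \<open>0 < y\<close> l] by (intro mult_right_mono) auto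
  also have "\<dots> = e * M (b / e)" using \<open>b > 0\<close> e by simp
  also have "\<dots> \<le> e * M y + e * M (b / e)"
    using growth_convex_nonneg[OF g, of y] assms by simp
  finally show ?thesis .
qed

text \<open>
  A substitute for \<open>M\<close> that is differentiable for \<open>x > 0\<close>.  Its derivative is at most \<open>M x / x\<close>, the
  quotient for which the Young type inequality above is stated.  At \<open>0\<close> its value is \<open>0\<close>, by division
  by zero.
\<close>

definition running_mean :: "(real \<Rightarrow> real) \<Rightarrow> real \<Rightarrow> real" where
  "running_mean M x = integral {0..x} M / x"

text \<open>
  Since \<open>M\<close> is increasing, the mean is at most \<open>M x\<close>, and the upper half of the interval alone shows
  that it is at least \<open>M (x / 2) / 2\<close>, which the growth condition compares with \<open>M x\<close>.
\<close>

lemma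
  assumes g: "growth_convex D M" and x: "0 < x"
  shows running_mean_nonneg: "0 \<le> running_mean M x"
    and running_mean_le: "running_mean M x \<le> M x"
    and le_running_mean: "M x \<le> 2 powr (D + 1) * running_mean M x"
    and running_mean_deriv:
      "(running_mean M has_real_derivative (M x - running_mean M x) / x) (at x)"
proof -
  have int: "M integrable_on {a..b}" if "0 \<le> a" for a b
    using that by (intro integrable_continuous_real
        continuous_on_subset[OF growth_convex_continuous[OF g]]) auto
  have "0 \<le> integral {0..x} M"
    using growth_convex_nonneg[OF g] by (intro integral_nonneg int) auto
  then show "0 \<le> running_mean M x" using x by (simp add: running_mean_def)
  have "integral {0..x} M \<le> integral {0..x} (\<lambda>_. M x)"
    by (intro integral_le int growth_convex_mono[OF g]) auto
  then show "running_mean M x \<le> M x" using x by (simp add: running_mean_def field_simps)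
  have "M x \<le> 2 powr D * M (x / 2)"
    using growth_convex_scale_up[OF g, of 2 "x / 2"] x by simp
  moreover have "integral {x / 2..x} (\<lambda>_. M (x / 2)) \<le> integral {x / 2..x} M"
    using x by (intro integral_le int growth_convex_mono[OF g]) auto
  moreover have "integral {x / 2..x} M \<le> integral {0..x} M"
    using x growth_convex_nonneg[OF g] by (intro integral_subset_le int) auto
  ultimately have le: "x * M x \<le> x * (2 powr D * M (x / 2))"
    and *: "x * M (x / 2) \<le> 2 * integral {0..x} M"
    using x by (auto intro: mult_left_mono)
  have "2 powr D * (x * M (x / 2)) \<le> 2 powr D * (2 * integral {0..x} M)"
    by (rule mult_left_mono[OF *]) simp
  with le have "x * M x \<le> 2 powr D * (2 * integral {0..x} M)"
    by (metis mult.left_commute order_trans)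
  then show "M x \<le> 2 powr (D + 1) * running_mean M x"
    using x by (simp add: running_mean_def field_simps powr_add)
  have "((\<lambda>u. integral {0..u} M) has_real_derivative M x) (at x within {0..x + 1})"
    using x by (intro integral_has_real_derivative
        continuous_on_subset[OF growth_convex_continuous[OF g]]) auto
  then have "((\<lambda>u. integral {0..u} M) has_real_derivative M x) (at x)"
    using x by (simp add: at_within_Icc_at)
  from DERIV_divide[OF this DERIV_ident] x
  show "(running_mean M has_real_derivative (M x - running_mean M x) / x) (at x)"
    unfolding running_mean_def[abs_def] by (simp add: field_simps power2_eq_square)
qed

lemma running_mean_continuous:
  assumes g: "growth_convex D M"
  shows "continuous_on {0..} (running_mean M)"
  unfolding continuous_on_def
proof
  fix x :: real assume "x \<in> {0..}"
  then consider "x = 0" | "x > 0" by fastforce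
  then show "(running_mean M \<longlongrightarrow> running_mean M x) (at x within {0..})"
  proof cases
    case 1
    have "(running_mean M \<longlongrightarrow> 0) (at 0 within {0..})"
    proof (rule tendsto_sandwich[where f = "\<lambda>_. 0" and h = M])
      show "\<forall>\<^sub>F x in at 0 within {0..}. 0 \<le> running_mean M x"
        using running_mean_nonneg[OF g] by (auto simp: eventually_at_filter)
      show "\<forall>\<^sub>F x in at 0 within {0..}. running_mean M x \<le> M x"
        using running_mean_le[OF g] by (auto simp: eventually_at_filter)
      show "(M \<longlongrightarrow> 0) (at 0 within {0..})"
        using growth_convex_continuous[OF g] growth_convex_zero[OF g]
        unfolding continuous_on_def by (metis atLeast_iff order_refl)
    qed auto
    then show ?thesis using 1 by (simp add: running_mean_def)
  next
    case 2
    show ?thesis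
      using DERIV_isCont[OF running_mean_deriv[OF g 2]]
      by (auto simp: isCont_def intro: tendsto_within_subset)
  qed
qed

section \<open>The pointwise differential inequality\<close>

definition radial_weight :: "nat \<Rightarrow> real \<Rightarrow> real" where
  "radial_weight n r = r ^ (n - 1) * exp (- r\<^sup>2 / 2)"

lemma radial_weight_nonneg: "0 \<le> r \<Longrightarrow> 0 \<le> radial_weight n r"
  by (simp add: radial_weight_def)

lemma continuous_on_radial_weight [continuous_intros]: "continuous_on A (radial_weight n)"
  unfolding radial_weight_def[abs_def] by (intro continuous_intros) auto

lemma radial_weight_measurable [measurable]: "radial_weight n \<in> borel_measurable borel"
  by (intro borel_measurable_continuous_onI continuous_intros)

lemma radial_weight_deriv:
  assumes "0 < r" "1 \<le> n"
  shows "(radial_weight n has_real_derivative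
           ((real n - 1) / r - r) * radial_weight n r) (at r)"
proof -
  have eq: "real (n - 1) * r ^ (n - Suc (Suc 0)) = (real n - 1) / r * r ^ (n - 1)"
  proof (cases "n = 1")
    case False
    then have "n - 1 = Suc (n - Suc (Suc 0))" using assms by linarith
    then show ?thesis using assms by (simp add: of_nat_diff)
  qed auto
  have "((\<lambda>r. r ^ (n - 1)) has_real_derivative real (n - 1) * r ^ (n - Suc (Suc 0))) (at r)"
    using DERIV_pow[of "n - 1" r] by simp
  moreover have "((\<lambda>r::real. exp (- r\<^sup>2 / 2)) has_real_derivative exp (- r\<^sup>2 / 2) * (- r)) (at r)"
    by (auto intro!: derivative_eq_intros)
  ultimately have "((\<lambda>r. r ^ (n - 1) * exp (- r\<^sup>2 / 2)) has_real_derivative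
      real (n - 1) * r ^ (n - Suc (Suc 0)) * exp (- r\<^sup>2 / 2) + exp (- r\<^sup>2 / 2) * (- r) * r ^ (n - 1)) (at r)"
    by (rule DERIV_mult)
  then show ?thesis
    unfolding eq radial_weight_def[abs_def] by (rule DERIV_cong) (simp add: left_diff_distrib)
qed

text \<open>
  Four times the constant in \<open>le_running_mean\<close>.  With this value, each of the two error terms that
  are multiples of \<open>M (r * w)\<close> costs a quarter of the main term, and half of it is left.
\<close>

definition absorb_const :: "real \<Rightarrow> real" where
  "absorb_const D = 4 * 2 powr (D + 1)"

text \<open>
  The square root is the radius beyond which \<open>(n + 1) * M (r * w) / (1 + r\<^sup>2)\<close> is absorbed by the
  main term; below this radius the growth condition bounds \<open>M (r * w)\<close> by a multiple of \<open>M w\<close>.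
\<close>

definition ray_const1 :: "nat \<Rightarrow> real \<Rightarrow> real" where
  "ray_const1 n D = absorb_const D * (real n + 1) * sqrt (absorb_const D * (real n + 1)) powr D"

definition ray_const2 :: "real \<Rightarrow> real" where
  "ray_const2 D = absorb_const D powr D"

text \<open>
  The quantity to which the fundamental theorem of calculus is applied.  The factor \<open>r / (1 + r\<^sup>2)\<close>
  behaves like \<open>1 / r\<close> at infinity and removes the boundary term at \<open>0\<close>.
\<close>

definition ray_potential :: "nat \<Rightarrow> (real \<Rightarrow> real) \<Rightarrow> (real \<Rightarrow> real) \<Rightarrow> real \<Rightarrow> real" where
  "ray_potential n M w r =
     running_mean M (r * w r) * (r / (1 + r\<^sup>2)) * radial_weight n r"

text \<open>
  The derivative of \<open>ray_potential\<close> divided by the weight, as a function of the values \<open>w\<close> and \<open>d\<close> of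
  the function and of its derivative at \<open>r\<close>.  The summands differentiate the running mean, the
  factor \<open>r / (1 + r\<^sup>2)\<close>, and the weight.
\<close>

definition ray_potential_deriv ::
    "nat \<Rightarrow> (real \<Rightarrow> real) \<Rightarrow> real \<Rightarrow> real \<Rightarrow> real \<Rightarrow> real" where
  "ray_potential_deriv n M w d r =
     (let y = r * w; A = running_mean M y in
       (M y - A) / y * (w + r * d) * (r / (1 + r\<^sup>2))
       + A * ((1 - r\<^sup>2) / (1 + r\<^sup>2)\<^sup>2)
       + A * (r / (1 + r\<^sup>2)) * ((real n - 1) / r - r))"

lemma ray_potential_has_deriv:
  assumes g: "growth_convex D M" and "1 \<le> n" "0 < r" "0 < w r"
    and w: "(w has_real_derivative d) (at r)"
  shows "(ray_potential n M w has_real_derivative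
           ray_potential_deriv n M (w r) d r * radial_weight n r) (at r)"
proof -
  have y: "((\<lambda>r. r * w r) has_real_derivative (w r + r * d)) (at r)"
    using w by (auto intro!: derivative_eq_intros)
  have A: "((\<lambda>r. running_mean M (r * w r)) has_real_derivative
      (M (r * w r) - running_mean M (r * w r)) / (r * w r) * (w r + r * d)) (at r)"
    using DERIV_chain2[OF running_mean_deriv[OF g] y] assms by simp
  have nz: "1 + r\<^sup>2 \<noteq> 0" by (smt (verit) zero_le_power2)
  have h: "((\<lambda>r. r / (1 + r\<^sup>2)) has_real_derivative (1 - r\<^sup>2) / (1 + r\<^sup>2)\<^sup>2) (at r)"
    by (rule derivative_eq_intros refl nz)+ (simp add: power2_eq_square algebra_simps)
  have regroup: "(X * h + h' * A) * W + c * W * (A * h) = (X * h + A * h' + A * h * c) * W"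
    for X h h' A W c :: real
    by (simp add: algebra_simps)
  show ?thesis
    unfolding ray_potential_def[abs_def] ray_potential_deriv_def Let_def
    by (rule DERIV_cong[OF DERIV_mult[OF DERIV_mult[OF A h]
            radial_weight_deriv[OF \<open>0 < r\<close> \<open>1 \<le> n\<close>]] regroup])
qed

text \<open>
  Write \<open>A\<close> for the running mean at \<open>y = r * w\<close>.  Differentiating the weight yields
  \<open>- A + n * A / (1 + r\<^sup>2)\<close>; together with the other terms that do not involve \<open>d\<close>, the sum is at most
  \<open>- A + (n + 1) * M y / (1 + r\<^sup>2)\<close>.  The term with \<open>d\<close> is handled by \<open>growth_convex_young\<close>.  All
  multiples of \<open>M y\<close> are then absorbed in \<open>- A\<close>, because \<open>A\<close> is bounded below by a multiple of \<open>M y\<close>.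
\<close>

lemma ray_potential_deriv_le:
  assumes g: "growth_convex D M" and D: "0 < D" and n: "1 \<le> n" and r: "0 < r" and w: "0 < w"
    and b: "\<bar>d\<bar> \<le> b"
  shows "2 / absorb_const D * M (r * w) + ray_potential_deriv n M w d r
    \<le> 1 / absorb_const D * (ray_const1 n D * M w + ray_const2 D * M b)"
proof -
  define K where "K = absorb_const D"
  define e where "e = 1 / K"
  define R where "R = sqrt (K * (real n + 1))"
  define y where "y = r * w"
  define A where "A = running_mean M y"
  define q where "q = 1 + r\<^sup>2"
  have K: "4 \<le> K" unfolding K_def absorb_const_def using D ge_one_powr_ge_zero[of 2 "D + 1"] by simp
  have e: "0 < e" "e \<le> 1" using K by (auto simp: e_def field_simps)
  have KR: "1 * 1 \<le> K * (real n + 1)" using K n by (intro mult_mono) auto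
  then have R1: "1 \<le> R" and R2: "R\<^sup>2 = K * (real n + 1)" by (auto simp: R_def)
  have y: "0 < y" using r w by (simp add: y_def)
  have q: "1 \<le> q" "r\<^sup>2 \<le> q" by (auto simp: q_def)
  have b0: "0 \<le> b" using b by linarith
  have My: "0 \<le> M y" and Mw: "0 \<le> M w" and Mb: "0 \<le> M b"
    using y w b0 by (auto intro: growth_convex_nonneg[OF g])
  have A0: "0 \<le> A" and AM: "A \<le> M y" and MA: "M y \<le> K / 4 * A"
    unfolding A_def using running_mean_nonneg[OF g y] running_mean_le[OF g y] le_running_mean[OF g y]
    by (auto simp: K_def absorb_const_def)
  \<comment> \<open>The only summand that contains \<open>d\<close>; the factor \<open>r\<^sup>2 / q \<le> 1\<close> is what is left of the
      product of \<open>r\<close> with the cut-off.\<close>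
  have t1: "(M y - A) / y * (r * d) * (r / q) \<le> e * M y + e * M (b / e)"
  proof -
    have "(M y - A) / y * (r * d) * (r / q) = (M y - A) / y * (r\<^sup>2 / q) * d"
      by (simp add: power2_eq_square)
    also have "\<dots> \<le> (M y - A) / y * (r\<^sup>2 / q) * b"
      using b AM y q by (intro mult_left_mono mult_nonneg_nonneg divide_nonneg_nonneg) auto
    also have "\<dots> \<le> M y / y * 1 * b"
      using b0 AM A0 y q by (intro mult_right_mono mult_mono divide_right_mono) auto
    also have "\<dots> \<le> e * M y + e * M (b / e)"
      using growth_convex_young[OF g y b0 e(1)] by simp
    finally show ?thesis .
  qed
  have t2: "(M y - A) / y * w * (r / q) = (M y - A) / q"
    using r w by (simp add: y_def)
  have t3: "A * ((1 - r\<^sup>2) / q\<^sup>2) \<le> A / q"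
  proof -
    have "(1 - r\<^sup>2) / q\<^sup>2 \<le> q / q\<^sup>2"
      using q by (intro divide_right_mono) (auto simp: q_def)
    also have "\<dots> = 1 / q" using q by (simp add: power2_eq_square)
    finally show ?thesis using mult_left_mono[OF _ A0] by fastforce
  qed
  have t4: "A * (r / q) * ((real n - 1) / r - r) = real n * (A / q) - A"
  proof -
    have "(r / q) * ((real n - 1) / r - r) = (real n - 1 - r\<^sup>2) / q"
      using r by (simp add: right_diff_distrib diff_divide_distrib power2_eq_square)
    also have "\<dots> = (real n - q) / q" by (simp add: q_def)
    also have "\<dots> = real n / q - 1" using q by (simp add: diff_divide_distrib)
    finally have "A * ((r / q) * ((real n - 1) / r - r)) = A * (real n / q - 1)" by simp
    also have "\<dots> = real n * (A / q) - A" by (simp add: right_diff_distrib)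
    finally show ?thesis by (simp only: mult.assoc)
  qed
  have "ray_potential_deriv n M w d r =
      (M y - A) / y * w * (r / q) + (M y - A) / y * (r * d) * (r / q)
      + A * ((1 - r\<^sup>2) / q\<^sup>2) + A * (r / q) * ((real n - 1) / r - r)"
    by (simp only: ray_potential_deriv_def Let_def y_def[symmetric] A_def[symmetric]
        q_def[symmetric] distrib_left distrib_right)
  also have "\<dots> \<le> (M y - A) / q + (e * M y + e * M (b / e)) + A / q + (real n * (A / q) - A)"
    using t1 t2 t3 t4 by linarith
  also have "\<dots> \<le> (real n + 1) * (M y / q) + e * M y + e * M (b / e) - A"
  proof -
    have "real n * (A / q) \<le> real n * (M y / q)"
      using AM q by (intro mult_left_mono divide_right_mono) auto
    moreover have "(M y - A) / q + A / q = M y / q" by (simp add: diff_divide_distrib)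
    moreover have "(real n + 1) * (M y / q) = real n * (M y / q) + M y / q"
      by (simp only: distrib_right mult_1_left)
    moreover have "s + (a + c) + u + (t - A) \<le> k + a + c - A"
      if "t \<le> t'" "s + u = m" "k = t' + m" for s a c u t t' m k
      using that by linarith
    ultimately show ?thesis by blast
  qed
  also have "\<dots> \<le> (real n + 1) * (R powr D * M w) + 2 * (e * M y) + e * M (b / e) - A"
  proof -
    have "M y / q \<le> R powr D * M w + M y / R\<^sup>2"
    \<comment> \<open>Small radii are paid for by \<open>M w\<close>, large radii by the main term.\<close>
    proof (cases "r \<le> R")
      case True
      have "M y / q \<le> M y / 1" using q My by (intro divide_left_mono) auto
      also have "\<dots> \<le> M (R * w)"
        using True w r by (auto intro!: growth_convex_mono[OF g] simp: y_def)
      also have "\<dots> \<le> R powr D * M w" using growth_convex_scale_up[OF g R1] w by simp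
      also have "\<dots> \<le> R powr D * M w + M y / R\<^sup>2" using My by simp
      finally show ?thesis .
    next
      case False
      then have "R\<^sup>2 \<le> q" using R1 q power_mono[of R r 2] by linarith
      then have "M y / q \<le> M y / R\<^sup>2"
        using R1 My q by (intro divide_left_mono mult_pos_pos) auto
      then show ?thesis using Mw by (smt (verit) mult_nonneg_nonneg powr_ge_zero)
    qed
    then have "(real n + 1) * (M y / q) \<le> (real n + 1) * (R powr D * M w + M y / R\<^sup>2)"
      by (intro mult_left_mono) auto
    also have "\<dots> = (real n + 1) * (R powr D * M w) + e * M y"
    proof -
      have "(real n + 1) * (M y / R\<^sup>2) = e * M y" using K by (simp add: R2 e_def)
      then show ?thesis by (simp add: distrib_left)
    qed
    finally show ?thesis by simp
  qed
  also have "\<dots> \<le> (real n + 1) * (R powr D * M w) + e * (K powr D * M b) - 2 * (e * M y)"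
  proof -
    have "M (b / e) \<le> K powr D * M b"
      using growth_convex_scale_up[OF g _ b0, of K] K by (simp add: e_def mult.commute)
    then have "e * M (b / e) \<le> e * (K powr D * M b)" using e by (intro mult_left_mono) auto
    moreover have "4 * (e * M y) \<le> A" using MA K by (simp add: e_def field_simps)
    ultimately show ?thesis by linarith
  qed
  finally have "2 * (e * M y) + ray_potential_deriv n M w d r
      \<le> (real n + 1) * (R powr D * M w) + e * (K powr D * M b)" by linarith
  also have "\<dots> = e * (ray_const1 n D * M w + ray_const2 D * M b)"
  proof -
    have "e * (K * (real n + 1) * R powr D * M w) = (real n + 1) * (R powr D * M w)"
      using K by (simp add: e_def)
    then show ?thesis
      unfolding ray_const1_def ray_const2_def K_def[symmetric] R_def[symmetric]
      by (simp only: distrib_left)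
  qed
  finally show ?thesis by (simp add: e_def K_def y_def)
qed

section \<open>The inequality on the half-line\<close>

lemma absorb_const_pos: "0 < absorb_const D"
  by (simp add: absorb_const_def)

lemma ray_const1_nonneg: "0 \<le> ray_const1 n D"
  using absorb_const_pos[of D] by (simp add: ray_const1_def)

lemma ray_const2_pos: "0 < ray_const2 D"
  using absorb_const_pos[of D] by (simp add: ray_const2_def)

lemma growth_convex_continuous_on_compose:
  assumes "growth_convex D M" "continuous_on A f" "\<And>x. x \<in> A \<Longrightarrow> 0 \<le> f x"
  shows "continuous_on A (\<lambda>x. M (f x))"
  by (rule continuous_on_compose2[OF growth_convex_continuous[OF assms(1)] assms(2)])
     (use assms(3) in auto)

text \<open>
  Integrating the pointwise bound; \<open>ray_potential\<close> vanishes at \<open>0\<close> and is nonnegative at \<open>R\<close>, so its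
  increment may be dropped.  Positivity of \<open>w\<close> makes \<open>r * w r\<close> positive for \<open>r > 0\<close>; at \<open>0\<close> the running mean
  need not be differentiable.  The derivative may be unbounded near the exceptional points, hence
  the gauge integral is used and integrability of the term with \<open>b\<close> is a hypothesis.
\<close>

lemma interval_inequality_positive:
  assumes g: "growth_convex D M" and D: "0 < D" and n: "1 \<le> n" and R: "0 \<le> R"
    and S: "finite S" and cw: "continuous_on {0..R} w" and w: "\<And>r. r \<in> {0..R} \<Longrightarrow> 0 < w r"
    and d: "\<And>r. r \<in> {0<..<R} - S \<Longrightarrow> (w has_real_derivative d r) (at r)"
    and b: "\<And>r. r \<in> {0<..<R} - S \<Longrightarrow> \<bar>d r\<bar> \<le> b r" "\<And>r. 0 \<le> b r"
    and int: "(\<lambda>r. M (b r) * radial_weight n r) integrable_on {0..R}"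
  shows "2 * integral {0..R} (\<lambda>r. M (r * w r) * radial_weight n r)
    \<le> ray_const1 n D * integral {0..R} (\<lambda>r. M (w r) * radial_weight n r)
      + ray_const2 D * integral {0..R} (\<lambda>r. M (b r) * radial_weight n r)"
proof -
  define K where "K = absorb_const D"
  \<comment> \<open>Outside the domain of the derivative the value is chosen so that the pointwise inequality
      persists there; this changes the integrand only at finitely many points of \<open>[0, R]\<close>.\<close>
  define F' where "F' r = (if r \<in> {0<..<R} - S
      then ray_potential_deriv n M (w r) (d r) r * radial_weight n r
      else - (2 / K * (M (r * w r) * radial_weight n r)))" for r
  have K: "0 < K" by (simp add: K_def absorb_const_pos)
  have pos: "r \<in> {0..R} \<Longrightarrow> 0 \<le> r * w r" "r \<in> {0..R} \<Longrightarrow> 0 \<le> w r" for r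
    using w[of r] by auto
  have "(F' has_integral (ray_potential n M w R - ray_potential n M w 0)) {0..R}"
  proof (rule fundamental_theorem_of_calculus_interior_strong[OF S R])
    fix r assume r: "r \<in> {0<..<R} - S"
    then show "(ray_potential n M w has_vector_derivative F' r) (at r)"
      using ray_potential_has_deriv[OF g n _ w d[OF r]] 
      by (simp add: F'_def has_real_derivative_iff_has_vector_derivative)
  next
    have "continuous_on {0..R} (\<lambda>r. running_mean M (r * w r))"
      by (rule continuous_on_compose2[OF running_mean_continuous[OF g]])
         (use pos in \<open>auto intro!: continuous_intros cw\<close>)
    moreover have "1 + r\<^sup>2 \<noteq> 0" for r :: real by (smt (verit) zero_le_power2)
    ultimately show "continuous_on {0..R} (ray_potential n M w)"
      unfolding ray_potential_def[abs_def] by (auto intro!: continuous_intros)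
  qed
  moreover have "ray_potential n M w 0 = 0" by (simp add: ray_potential_def)
  moreover have "0 \<le> ray_potential n M w R"
  proof (cases "R = 0")
    case False
    then have "0 < R * w R" using w[of R] R by auto
    then show ?thesis
      using running_mean_nonneg[OF g] radial_weight_nonneg[OF R] R by (simp add: ray_potential_def)
  qed (simp add: ray_potential_def)
  ultimately obtain I where F': "(F' has_integral I) {0..R}" and I: "0 \<le> I" by force
  have i1: "(\<lambda>r. M (r * w r) * radial_weight n r) integrable_on {0..R}"
    and i2: "(\<lambda>r. M (w r) * radial_weight n r) integrable_on {0..R}"
    using pos by (auto intro!: integrable_continuous_real continuous_intros cw
        growth_convex_continuous_on_compose[OF g])
  have "2 / K * integral {0..R} (\<lambda>r. M (r * w r) * radial_weight n r) + I
    \<le> 1 / K * (ray_const1 n D * integral {0..R} (\<lambda>r. M (w r) * radial_weight n r)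
      + ray_const2 D * integral {0..R} (\<lambda>r. M (b r) * radial_weight n r))"
  proof (rule has_integral_le)
    show "((\<lambda>r. 2 / K * (M (r * w r) * radial_weight n r) + F' r) has_integral
        2 / K * integral {0..R} (\<lambda>r. M (r * w r) * radial_weight n r) + I) {0..R}"
      by (intro has_integral_add has_integral_mult_right integrable_integral i1 F')
    show "((\<lambda>r. 1 / K * (ray_const1 n D * (M (w r) * radial_weight n r)
          + ray_const2 D * (M (b r) * radial_weight n r))) has_integral
        1 / K * (ray_const1 n D * integral {0..R} (\<lambda>r. M (w r) * radial_weight n r)
      + ray_const2 D * integral {0..R} (\<lambda>r. M (b r) * radial_weight n r))) {0..R}"
      by (intro has_integral_add has_integral_mult_right integrable_integral i2 int)
    fix r assume r: "r \<in> {0..R}"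
    show "2 / K * (M (r * w r) * radial_weight n r) + F' r
      \<le> 1 / K * (ray_const1 n D * (M (w r) * radial_weight n r)
          + ray_const2 D * (M (b r) * radial_weight n r))"
    proof (cases "r \<in> {0<..<R} - S")
      case True
      then have "2 / K * M (r * w r) + ray_potential_deriv n M (w r) (d r) r
          \<le> 1 / K * (ray_const1 n D * M (w r) + ray_const2 D * M (b r))"
        unfolding K_def using w[OF r] b by (intro ray_potential_deriv_le[OF g D n]) auto
      from mult_right_mono[OF this radial_weight_nonneg[of r n]] r True show ?thesis
        by (simp add: F'_def algebra_simps)
    next
      case False
      have "0 \<le> 1 / K * (ray_const1 n D * (M (w r) * radial_weight n r)
          + ray_const2 D * (M (b r) * radial_weight n r))"
        using r K pos(2)[OF r] b(2) ray_const1_nonneg[of n D] ray_const2_pos[of D]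
        by (intro mult_nonneg_nonneg add_nonneg_nonneg growth_convex_nonneg[OF g]
            radial_weight_nonneg) auto
      moreover have "F' r = - (2 / K * (M (r * w r) * radial_weight n r))"
        unfolding F'_def using False by (rule if_not_P)
      ultimately show ?thesis by linarith
    qed
  qed
  then have "K * (2 / K * integral {0..R} (\<lambda>r. M (r * w r) * radial_weight n r))
    \<le> K * (1 / K * (ray_const1 n D * integral {0..R} (\<lambda>r. M (w r) * radial_weight n r)
      + ray_const2 D * integral {0..R} (\<lambda>r. M (b r) * radial_weight n r)))"
    using I K by (intro mult_left_mono) auto
  then show ?thesis using K by simp
qed

text \<open>
  The positive function \<open>sqrt (v\<^sup>2 + \<delta>\<^sup>2)\<close> has slope at most \<open>\<bar>v'\<bar>\<close> and lies between \<open>\<bar>v\<bar>\<close> and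
  \<open>\<bar>v\<bar> + \<delta>\<close>.  Splitting \<open>M (\<bar>v\<bar> + \<delta>)\<close> costs the factor \<open>2 powr D\<close> and an error proportional to
  \<open>M \<delta>\<close>, which tends to \<open>0\<close>.
\<close>

lemma interval_inequality:
  assumes g: "growth_convex D M" and D: "0 < D" and n: "1 \<le> n" and R: "0 \<le> R"
    and S: "finite S" and cv: "continuous_on {0..R} v"
    and d: "\<And>r. r \<in> {0<..<R} - S \<Longrightarrow> (v has_real_derivative d r) (at r)"
    and int: "(\<lambda>r. M \<bar>d r\<bar> * radial_weight n r) integrable_on {0..R}"
  shows "2 * integral {0..R} (\<lambda>r. M (r * \<bar>v r\<bar>) * radial_weight n r)
    \<le> ray_const1 n D * 2 powr D * integral {0..R} (\<lambda>r. M \<bar>v r\<bar> * radial_weight n r)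
      + ray_const2 D * integral {0..R} (\<lambda>r. M \<bar>d r\<bar> * radial_weight n r)"
    (is "?L \<le> ?A * ?V + ?B")
proof -
  define W0 where "W0 = integral {0..R} (radial_weight n)"
  have eps: "?L \<le> ?A * (?V + M \<delta> * W0) + ?B" if "0 < \<delta>" for \<delta>
  proof -
    define w where "w r = sqrt ((v r)\<^sup>2 + \<delta>\<^sup>2)" for r
    have pos: "0 < (v r)\<^sup>2 + \<delta>\<^sup>2" for r using that by (simp add: add_nonneg_pos)
    have vw: "\<bar>v r\<bar> \<le> w r" and wv: "w r \<le> \<bar>v r\<bar> + \<delta>" and w0: "0 < w r" for r
      using pos[of r] that sqrt_sum_squares_le_sum_abs[of "v r" \<delta>]
      by (auto simp: w_def intro: real_le_rsqrt)
    have cw: "continuous_on {0..R} w"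
      unfolding w_def by (intro continuous_intros cv)
    have i: "(\<lambda>r. M (r * w r) * radial_weight n r) integrable_on {0..R}"
      "(\<lambda>r. M (w r) * radial_weight n r) integrable_on {0..R}"
      "(\<lambda>r. M (r * \<bar>v r\<bar>) * radial_weight n r) integrable_on {0..R}"
      "(\<lambda>r. M \<bar>v r\<bar> * radial_weight n r) integrable_on {0..R}"
      "radial_weight n integrable_on {0..R}"
      using w0 by (auto intro!: integrable_continuous_real continuous_intros cw cv
          growth_convex_continuous_on_compose[OF g] simp: less_imp_le)
    have "?L \<le> 2 * integral {0..R} (\<lambda>r. M (r * w r) * radial_weight n r)"
      using vw by (intro mult_left_mono integral_le i mult_right_mono growth_convex_mono[OF g]
          radial_weight_nonneg) auto
    also have "\<dots> \<le> ray_const1 n D * integral {0..R} (\<lambda>r. M (w r) * radial_weight n r) + ?B"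
    proof (rule interval_inequality_positive[OF g D n R S cw])
      fix r assume r: "r \<in> {0<..<R} - S"
      have "((\<lambda>r. sqrt ((v r)\<^sup>2 + \<delta>\<^sup>2)) has_real_derivative
          inverse (sqrt ((v r)\<^sup>2 + \<delta>\<^sup>2)) / 2 * (2 * v r * d r)) (at r)"
        by (rule DERIV_chain2[where f = sqrt and g = "\<lambda>r. (v r)\<^sup>2 + \<delta>\<^sup>2",
              OF DERIV_real_sqrt[OF pos[of r]]])
           (use d[OF r] in \<open>auto intro!: derivative_eq_intros\<close>)
      then show "(w has_real_derivative v r / w r * d r) (at r)"
        unfolding w_def[abs_def] by (rule DERIV_cong) (simp add: field_simps)
      have "\<bar>v r / w r\<bar> \<le> 1" using vw[of r] w0[of r] by (simp add: abs_divide)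
      then show "\<bar>v r / w r * d r\<bar> \<le> \<bar>d r\<bar>"
        unfolding abs_mult using mult_right_mono[of _ 1 "\<bar>d r\<bar>"] by fastforce
    qed (use w0 int in auto)
    also have "ray_const1 n D * integral {0..R} (\<lambda>r. M (w r) * radial_weight n r)
        \<le> ray_const1 n D * (2 powr D * (?V + M \<delta> * W0))"
    proof (rule mult_left_mono[OF _ ray_const1_nonneg])
      have "integral {0..R} (\<lambda>r. M (w r) * radial_weight n r)
          \<le> integral {0..R} (\<lambda>r. 2 powr D * (M \<bar>v r\<bar> * radial_weight n r + M \<delta> * radial_weight n r))"
      proof (rule integral_le)
        fix r assume r: "r \<in> {0..R}"
        have "M (w r) \<le> M (\<bar>v r\<bar> + \<delta>)"
          using wv w0 by (intro growth_convex_mono[OF g]) (auto simp: less_imp_le)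
        also have "\<dots> \<le> 2 powr D * (M \<bar>v r\<bar> + M \<delta>)"
          using that by (intro growth_convex_quasi_subadditive[OF g]) auto
        finally show "M (w r) * radial_weight n r
            \<le> 2 powr D * (M \<bar>v r\<bar> * radial_weight n r + M \<delta> * radial_weight n r)"
          using mult_right_mono[OF _ radial_weight_nonneg[of r n]] r
          by (fastforce simp: algebra_simps)
      qed (use i in \<open>auto intro!: integrable_on_mult_right integrable_add\<close>)
      also have "\<dots> = 2 powr D * (?V + M \<delta> * W0)"
        using i by (simp add: integral_add integrable_on_mult_right W0_def)
      finally show "integral {0..R} (\<lambda>r. M (w r) * radial_weight n r)
          \<le> 2 powr D * (?V + M \<delta> * W0)" .
    qed
    finally show ?thesis by (simp add: mult.assoc)
  qed
  have "(M \<longlongrightarrow> 0) (at_right 0)"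
  proof -
    have "(M \<longlongrightarrow> M 0) (at 0 within {0..})"
      using growth_convex_continuous[OF g] unfolding continuous_on_def by auto
    then have "(M \<longlongrightarrow> M 0) (at_right 0)" by (rule tendsto_within_subset) auto
    then show ?thesis using growth_convex_zero[OF g] by simp
  qed
  then have "((\<lambda>\<delta>. ?A * (?V + M \<delta> * W0) + ?B) \<longlongrightarrow> ?A * (?V + 0 * W0) + ?B) (at_right 0)"
    by (intro tendsto_intros)
  then have "?L \<le> ?A * (?V + 0 * W0) + ?B"
    by (rule tendsto_lowerbound) (use eps in \<open>auto simp: eventually_at_right_less eventually_at_filter\<close>)
  then show ?thesis by simp
qed

text \<open>
  The exceptional sets of the initial segments need not be compatible with each other.  The open set
  of all points that are regular for some segment serves all segments at once.
\<close>

lemma piecewise_C1_halflineE: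
  assumes "piecewise_C1_halfline v"
  obtains \<Omega> where "continuous_on {0..} v" "open \<Omega>" "\<And>R. finite ({0..R} - \<Omega>)"
    "\<And>r. r \<in> \<Omega> \<Longrightarrow> (v has_real_derivative deriv v r) (at r)" "continuous_on \<Omega> (deriv v)"
proof -
  have "\<forall>k. \<exists>S. finite S \<and> continuous_on {0..real (Suc k)} v \<and>
      v C1_differentiable_on ({0..real (Suc k)} - S)"
    using assms by (auto simp: piecewise_C1_halfline_def piecewise_C1_differentiable_on_def)
  then obtain S where S: "\<And>k. finite (S k)" and cv: "\<And>k. continuous_on {0..real (Suc k)} v"
    and C1: "\<And>k. v C1_differentiable_on ({0..real (Suc k)} - S k)" by metis
  define O' where "O' k = {0<..<real (Suc k)} - S k" for k
  define \<Omega> where "\<Omega> = (\<Union>k. O' k)"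
  have op: "open (O' k)" for k
    unfolding O'_def by (intro open_Diff finite_imp_closed S) auto
  have der: "(v has_real_derivative deriv v r) (at r)" if "r \<in> O' k" for r k
    using C1[of k] that
    by (auto simp: C1_differentiable_on_def O'_def real_differentiable_def
        has_real_derivative_iff_has_vector_derivative[symmetric] DERIV_imp_deriv)
       (metis DERIV_imp_deriv DiffI atLeastAtMost_iff less_imp_le)
  have cd: "continuous_on (O' k) (deriv v)" for k
  proof -
    obtain E where E: "\<And>r. r \<in> {0..real (Suc k)} - S k \<Longrightarrow> (v has_vector_derivative E r) (at r)"
      "continuous_on ({0..real (Suc k)} - S k) E"
      using C1[of k] unfolding C1_differentiable_on_def by blast
    have "continuous_on (O' k) E"
      by (rule continuous_on_subset[OF E(2)]) (auto simp: O'_def)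
    moreover have "deriv v r = E r" if "r \<in> O' k" for r
      using E(1)[of r] that
      by (auto simp: O'_def has_real_derivative_iff_has_vector_derivative[symmetric] intro!: DERIV_imp_deriv)
    ultimately show ?thesis by (simp cong: continuous_on_cong)
  qed
  show thesis
  proof
    show "continuous_on {0..} v"
      unfolding continuous_on_eq_continuous_within
    proof
      fix x :: real assume x: "x \<in> {0..}"
      obtain k where k: "x < real (Suc k)" by (meson lessI less_trans of_nat_less_iff reals_Archimedean2)
      have "continuous (at x within {0..real (Suc k)}) v"
        using cv[of k] x k by (auto simp: continuous_on_eq_continuous_within)
      moreover have "at x within {0..real (Suc k)} = at x within {0..}"
        by (rule at_within_nhd[of _ "{..<real (Suc k)}"]) (use k x in auto)
      ultimately show "continuous (at x within {0..}) v" by simp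
    qed
    show "open \<Omega>" unfolding \<Omega>_def using op by auto
    show "finite ({0..R} - \<Omega>)" for R
    proof -
      obtain k where k: "R < real (Suc k)" by (meson lessI less_trans of_nat_less_iff reals_Archimedean2)
      have "{0..R} - \<Omega> \<subseteq> {0..R} - O' k" unfolding \<Omega>_def by auto
      also have "\<dots> \<subseteq> {0} \<union> S k" using k by (auto simp: O'_def)
      finally show ?thesis using S[of k] by (auto intro: finite_subset)
    qed
    show "continuous_on \<Omega> (deriv v)"
      unfolding \<Omega>_def using op cd by (intro continuous_on_open_UN) auto
  qed (use der in \<open>auto simp: \<Omega>_def\<close>)
qed

lemma growth_convex_halfline_measurable:
  fixes f :: "real \<Rightarrow> real"
  assumes g: "growth_convex D M" and f: "(\<lambda>r. indicator {0..} r * f r) \<in> borel_measurable borel"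
    and nn: "\<And>r. 0 \<le> r \<Longrightarrow> 0 \<le> f r"
  shows "(\<lambda>r. ennreal (M (f r)) * indicator {0..} r) \<in> borel_measurable borel"
proof -
  have "(\<lambda>r. ennreal (M \<bar>indicator {0..} r * f r\<bar>) * indicator {0..} r) \<in> borel_measurable borel"
    using f by (intro borel_measurable_times_ennreal measurable_compose[OF _ measurable_ennreal]
        growth_convex_measurable[OF g] borel_measurable_indicator) simp_all
  also have "(\<lambda>r. ennreal (M \<bar>indicator {0..} r * f r\<bar>) * indicator {0..} r)
      = (\<lambda>r. ennreal (M (f r)) * indicator {0..} r)"
    using nn by (auto simp: fun_eq_iff indicator_def)
  finally show ?thesis .
qed

lemma nn_integral_mu:
  assumes "(\<lambda>r. ennreal (f r) * indicator {0..} r) \<in> borel_measurable borel"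
  shows "(\<integral>\<^sup>+ r\<in>{0..}. ennreal (f r) \<partial>mu n) = (\<integral>\<^sup>+ r\<in>{0..}. ennreal (f r * radial_weight n r) \<partial>lborel)"
proof -
  have "(\<integral>\<^sup>+ r\<in>{0..}. ennreal (f r) \<partial>mu n)
      = (\<integral>\<^sup>+ r. ennreal (indicator {0..} r * r ^ (n - 1) * exp (- r\<^sup>2 / 2))
          * (ennreal (f r) * indicator {0..} r) \<partial>lborel)"
    unfolding mu_def using assms by (subst nn_integral_density) auto
  also have "\<dots> = (\<integral>\<^sup>+ r\<in>{0..}. ennreal (f r * radial_weight n r) \<partial>lborel)"
    by (intro nn_integral_cong)
       (auto simp: indicator_def radial_weight_def ennreal_mult'' mult_ac)
  finally show ?thesis .
qed

text \<open>
  Monotone convergence in \<open>R\<close> extends the inequality to the half-line.  If the integral of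
  \<open>M \<bar>v'\<bar>\<close> over some segment is infinite there is nothing to prove; otherwise the integrand is
  integrable there and \<open>interval_inequality\<close> applies.  Its factor \<open>2\<close> on the left is discarded.
\<close>

lemma halfline_inequality:
  assumes g: "growth_convex D M" and D: "0 < D" and n: "1 \<le> n" and v: "piecewise_C1_halfline v"
  shows "(\<integral>\<^sup>+ r\<in>{0..}. ennreal (M (r * \<bar>v r\<bar>)) \<partial>mu n)
    \<le> ennreal (ray_const1 n D * 2 powr D) * (\<integral>\<^sup>+ r\<in>{0..}. ennreal (M \<bar>v r\<bar>) \<partial>mu n)
      + ennreal (ray_const2 D) * (\<integral>\<^sup>+ r\<in>{0..}. ennreal (M \<bar>deriv v r\<bar>) \<partial>mu n)"
proof -
  from v obtain \<Omega> where cv: "continuous_on {0..} v" and op: "open \<Omega>"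
    and fin: "\<And>R. finite ({0..R} - \<Omega>)"
    and der: "\<And>r. r \<in> \<Omega> \<Longrightarrow> (v has_real_derivative deriv v r) (at r)"
    and cd: "continuous_on \<Omega> (deriv v)"
    by (rule piecewise_C1_halflineE) blast
  let ?W = "radial_weight n"
  define A where "A = ray_const1 n D * 2 powr D"
  define C where "C = ray_const2 D"
  have A: "0 \<le> A" and C: "0 < C" using ray_const1_nonneg ray_const2_pos by (auto simp: A_def C_def)
  have mv: "(\<lambda>r. indicator {0..} r * v r) \<in> borel_measurable borel"
    using borel_measurable_continuous_on_indicator[OF _ cv] by simp
  have m1: "(\<lambda>r. ennreal (M (r * \<bar>v r\<bar>)) * indicator {0..} r) \<in> borel_measurable borel"
  proof (rule growth_convex_halfline_measurable[OF g])
    have "(\<lambda>r. r * \<bar>indicator {0..} r * v r\<bar>) \<in> borel_measurable borel" using mv by simp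
    also have "(\<lambda>r. r * \<bar>indicator {0..} r * v r\<bar>) = (\<lambda>r. indicator {0..} r * (r * \<bar>v r\<bar>))"
      by (auto simp: fun_eq_iff indicator_def)
    finally show "\<dots> \<in> borel_measurable borel" .
  qed auto
  have m2: "(\<lambda>r. ennreal (M \<bar>v r\<bar>) * indicator {0..} r) \<in> borel_measurable borel"
  proof (rule growth_convex_halfline_measurable[OF g])
    have "(\<lambda>r. \<bar>indicator {0..} r * v r\<bar>) \<in> borel_measurable borel" using mv by simp
    also have "(\<lambda>r. \<bar>indicator {0..} r * v r\<bar>) = (\<lambda>r. indicator {0..} r * \<bar>v r\<bar>)"
      by (auto simp: fun_eq_iff indicator_def)
    finally show "\<dots> \<in> borel_measurable borel" .
  qed auto
  have m3: "(\<lambda>r. ennreal (M \<bar>deriv v r\<bar>) * indicator {0..} r) \<in> borel_measurable borel"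
  proof (rule growth_convex_halfline_measurable[OF g])
    have "(\<lambda>r. \<bar>indicator \<Omega> r * deriv v r\<bar> * indicator {0..} r) \<in> borel_measurable borel"
    proof (rule borel_measurable_times[OF borel_measurable_abs borel_measurable_indicator])
      show "(\<lambda>r. indicator \<Omega> r * deriv v r) \<in> borel_measurable borel"
        using borel_measurable_continuous_on_indicator[OF _ cd] op by simp
    qed simp
    moreover have "countable ({0..} - \<Omega>)"
    proof (rule countable_subset)
      show "{0..} - \<Omega> \<subseteq> (\<Union>k. {0..real k} - \<Omega>)" using real_arch_simple by fastforce
      show "countable (\<Union>k. {0..real k} - \<Omega>)" 
        by (rule countable_UN[OF _ countable_finite[OF fin]]) simp
    qed
    ultimately show "(\<lambda>r. indicator {0..} r * \<bar>deriv v r\<bar>) \<in> borel_measurable borel"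
      by (rule measurable_discrete_difference) (auto simp: indicator_def)
  qed auto
  note mus = nn_integral_mu[OF m1] nn_integral_mu[OF m2] nn_integral_mu[OF m3]
  define I where "I f R = (\<integral>\<^sup>+ r\<in>{0..R}. ennreal (f r * ?W r) \<partial>lborel)" for f R
  have I_le: "I f R \<le> (\<integral>\<^sup>+ r\<in>{0..}. ennreal (f r * ?W r) \<partial>lborel)" for f R
    unfolding I_def by (intro nn_integral_mono) (auto simp: indicator_def)
  have bounded: "I (\<lambda>r. M (r * \<bar>v r\<bar>)) (real k)
      \<le> ennreal A * I (\<lambda>r. M \<bar>v r\<bar>) (real k) + ennreal C * I (\<lambda>r. M \<bar>deriv v r\<bar>) (real k)" for k
  proof (cases "I (\<lambda>r. M \<bar>deriv v r\<bar>) (real k) = \<infinity>")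
    case True
    then show ?thesis using C by (simp add: ennreal_mult_top)
  next
    case False
    have cvk: "continuous_on {0..real k} v" by (rule continuous_on_subset[OF cv]) auto
    have "(\<lambda>r. indicator {0..real k} r * (M \<bar>deriv v r\<bar> * ?W r)) integrable_on UNIV"
    proof (rule nn_integral_integrable_on)
      have "(\<lambda>r. enn2real (ennreal (M \<bar>deriv v r\<bar>) * indicator {0..} r) * ?W r * indicator {0..real k} r)
          \<in> borel_measurable borel"
        using m3 by (intro borel_measurable_times borel_measurable_enn2real
            radial_weight_measurable borel_measurable_indicator) simp_all
      also have "(\<lambda>r. enn2real (ennreal (M \<bar>deriv v r\<bar>) * indicator {0..} r) * ?W r * indicator {0..real k} r)
          = (\<lambda>r. indicator {0..real k} r * (M \<bar>deriv v r\<bar> * ?W r))"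
        using growth_convex_nonneg[OF g] by (auto simp: fun_eq_iff indicator_def)
      finally show "(\<lambda>r. indicator {0..real k} r * (M \<bar>deriv v r\<bar> * ?W r)) \<in> borel_measurable borel" .
      show "0 \<le> indicator {0..real k} r * (M \<bar>deriv v r\<bar> * ?W r)" for r
        using growth_convex_nonneg[OF g] radial_weight_nonneg by (auto simp: indicator_def)
      have "(\<integral>\<^sup>+ r. ennreal (indicator {0..real k} r * (M \<bar>deriv v r\<bar> * ?W r)) \<partial>lborel)
          = I (\<lambda>r. M \<bar>deriv v r\<bar>) (real k)"
        unfolding I_def by (intro nn_integral_cong) (auto simp: indicator_def)
      then show "(\<integral>\<^sup>+ r. ennreal (indicator {0..real k} r * (M \<bar>deriv v r\<bar> * ?W r)) \<partial>lborel) < \<infinity>"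
        using False by (simp add: less_top)
    qed
    then have "(\<lambda>r. if r \<in> {0..real k} then M \<bar>deriv v r\<bar> * ?W r else 0) integrable_on UNIV"
      by (rule integrable_eq) (auto simp: indicator_def)
    then have i3: "(\<lambda>r. M \<bar>deriv v r\<bar> * ?W r) integrable_on {0..real k}"
      by (simp only: integrable_restrict_UNIV)
    have i1: "(\<lambda>r. M (r * \<bar>v r\<bar>) * ?W r) integrable_on {0..real k}"
      and i2: "(\<lambda>r. M \<bar>v r\<bar> * ?W r) integrable_on {0..real k}"
      by (auto intro!: integrable_continuous_real continuous_intros cvk
          growth_convex_continuous_on_compose[OF g])
    have eq: "I f (real k) = ennreal (integral {0..real k} (\<lambda>r. f r * ?W r))"
      and nn: "0 \<le> integral {0..real k} (\<lambda>r. f r * ?W r)"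
      if "(\<lambda>r. f r * ?W r) integrable_on {0..real k}" "\<And>r. 0 \<le> r \<Longrightarrow> 0 \<le> f r" for f
    proof -
      have "0 \<le> f r * ?W r" if "r \<in> {0..real k}" for r
        using that \<open>\<And>r. 0 \<le> r \<Longrightarrow> 0 \<le> f r\<close> radial_weight_nonneg by simp
      note pos = this
      show "I f (real k) = ennreal (integral {0..real k} (\<lambda>r. f r * ?W r))"
        unfolding I_def by (rule nn_integral_has_integral_lebesgue'[OF pos integrable_integral[OF that(1)]])
      show "0 \<le> integral {0..real k} (\<lambda>r. f r * ?W r)"
        by (rule integral_nonneg[OF that(1) pos])
    qed
    have M0: "0 \<le> M (r * \<bar>v r\<bar>)" "0 \<le> M \<bar>v r\<bar>" "0 \<le> M \<bar>deriv v r\<bar>" if "0 \<le> r" for r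
      using growth_convex_nonneg[OF g] that by auto
    have "2 * integral {0..real k} (\<lambda>r. M (r * \<bar>v r\<bar>) * ?W r)
      \<le> A * integral {0..real k} (\<lambda>r. M \<bar>v r\<bar> * ?W r)
        + C * integral {0..real k} (\<lambda>r. M \<bar>deriv v r\<bar> * ?W r)"
      unfolding A_def C_def
      by (rule interval_inequality[OF g D n _ fin[of "real k"] cvk]) (use der i3 in auto)
    then have "ennreal (integral {0..real k} (\<lambda>r. M (r * \<bar>v r\<bar>) * ?W r))
      \<le> ennreal (A * integral {0..real k} (\<lambda>r. M \<bar>v r\<bar> * ?W r)
        + C * integral {0..real k} (\<lambda>r. M \<bar>deriv v r\<bar> * ?W r))"
      using nn[OF i1 M0(1)] by (intro ennreal_leI) linarith
    then show ?thesis
      using A C nn[OF i2 M0(2)] nn[OF i3 M0(3)]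
      by (simp only: eq[OF i1 M0(1)] eq[OF i2 M0(2)] eq[OF i3 M0(3)]
          ennreal_plus ennreal_mult mult_nonneg_nonneg less_imp_le)
  qed
  \<comment> \<open>Monotone convergence in the form of continuity from below of a measure.\<close>
  define N where "N = density lborel (\<lambda>r. ennreal (M (r * \<bar>v r\<bar>)) * indicator {0..} r * ennreal (?W r))"
  have measW: "(\<lambda>r. ennreal (M (r * \<bar>v r\<bar>)) * indicator {0..} r * ennreal (?W r))
      \<in> borel_measurable lborel"
    using borel_measurable_times_ennreal[OF m1
        measurable_compose[OF radial_weight_measurable[of n] measurable_ennreal]]
    by (simp only: measurable_lborel1 measurable_lborel2)
  have N: "emeasure N B = (\<integral>\<^sup>+ r\<in>B. ennreal (M (r * \<bar>v r\<bar>) * ?W r) \<partial>lborel)"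
    if "B \<in> sets borel" "B \<subseteq> {0..}" for B
  proof -
    have "emeasure N B = (\<integral>\<^sup>+ r\<in>B. ennreal (M (r * \<bar>v r\<bar>)) * indicator {0..} r * ennreal (?W r) \<partial>lborel)"
      unfolding N_def using that(1) measW by (intro emeasure_density) auto
    also have "\<dots> = (\<integral>\<^sup>+ r\<in>B. ennreal (M (r * \<bar>v r\<bar>) * ?W r) \<partial>lborel)"
      using that(2) radial_weight_nonneg
      by (intro nn_integral_cong) (auto simp: indicator_def ennreal_mult'')
    finally show ?thesis .
  qed
  have "(\<integral>\<^sup>+ r\<in>{0..}. ennreal (M (r * \<bar>v r\<bar>) * ?W r) \<partial>lborel) = emeasure N (\<Union>k. {0..real k})"
  proof -
    have "(\<Union>k. {0..real k}) = {0..}" using real_arch_simple by fastforce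
    then show ?thesis using N[of "{0..}"] by simp
  qed
  also have "\<dots> = (SUP k. emeasure N {0..real k})"
    by (rule SUP_emeasure_incseq[symmetric]) (auto simp: N_def incseq_def)
  also have "\<dots> \<le> ennreal A * (\<integral>\<^sup>+ r\<in>{0..}. ennreal (M \<bar>v r\<bar> * ?W r) \<partial>lborel)
      + ennreal C * (\<integral>\<^sup>+ r\<in>{0..}. ennreal (M \<bar>deriv v r\<bar> * ?W r) \<partial>lborel)"
  proof (rule SUP_least)
    fix k
    have "emeasure N {0..real k} = I (\<lambda>r. M (r * \<bar>v r\<bar>)) (real k)"
      by (subst N) (auto simp: I_def)
    also note bounded
    also have "ennreal A * I (\<lambda>r. M \<bar>v r\<bar>) (real k) + ennreal C * I (\<lambda>r. M \<bar>deriv v r\<bar>) (real k)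
        \<le> ennreal A * (\<integral>\<^sup>+ r\<in>{0..}. ennreal (M \<bar>v r\<bar> * ?W r) \<partial>lborel)
          + ennreal C * (\<integral>\<^sup>+ r\<in>{0..}. ennreal (M \<bar>deriv v r\<bar> * ?W r) \<partial>lborel)"
      by (intro add_mono mult_left_mono I_le) auto
    finally show "emeasure N {0..real k} \<le> \<dots>" .
  qed
  finally show ?thesis unfolding mus A_def C_def .
qed

section \<open>Polar integration by dilations\<close>

lemma nn_integral_lborel_scaleR:
  fixes f :: "'a::euclidean_space \<Rightarrow> ennreal"
  assumes "0 < c" and f[measurable]: "f \<in> borel_measurable borel"
  shows "(\<integral>\<^sup>+ x. f x \<partial>lborel) = ennreal (c ^ DIM('a)) * (\<integral>\<^sup>+ x. f (c *\<^sub>R x) \<partial>lborel)"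
proof -
  have "(\<integral>\<^sup>+ x. f x \<partial>lborel)
      = (\<integral>\<^sup>+ x. f x \<partial>density (distr lborel borel (\<lambda>x::'a. 0 + c *\<^sub>R x)) (\<lambda>_. ennreal (\<bar>c\<bar> ^ DIM('a))))"
    using assms(1) by (subst lborel_affine[of c 0]) auto
  also have "\<dots> = ennreal (c ^ DIM('a)) * (\<integral>\<^sup>+ x. f (c *\<^sub>R x) \<partial>lborel)"
    using assms(1) by (simp add: nn_integral_density nn_integral_distr nn_integral_cmult)
  finally show ?thesis .
qed

lemma nn_integral_inverse_dyadic:
  assumes "0 < \<rho>"
  shows "(\<integral>\<^sup>+ t\<in>{\<rho> / 2..\<rho>}. ennreal (1 / t) \<partial>lborel) = ennreal (ln 2)"
proof -
  have "((\<lambda>t. 1 / t) has_integral ln \<rho> - ln (\<rho> / 2)) {\<rho> / 2..\<rho>}"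
    using assms
    by (intro fundamental_theorem_of_calculus)
       (auto intro!: derivative_eq_intros simp flip: has_real_derivative_iff_has_vector_derivative)
  moreover have "ln \<rho> - ln (\<rho> / 2) = ln 2" using assms by (simp add: ln_div)
  ultimately show ?thesis
    using assms by (intro nn_integral_has_integral_lebesgue') auto
qed

definition shell :: "'a::euclidean_space set" where
  "shell = {y. 1 \<le> norm y \<and> norm y \<le> 2}"

lemma shell_measurable [measurable]: "shell \<in> sets borel"
  unfolding shell_def by measurable

text \<open>
  Integrate \<open>H\<close> along the ray through every point \<open>y\<close> of the shell.  For fixed \<open>t\<close>, dilation by
  \<open>t\<close> turns the integral over \<open>y\<close> into one over \<open>x = t * y\<close>, leaving the factor \<open>1 / t\<close>.  A fixed
  \<open>x \<noteq> 0\<close> is reached exactly for \<open>t\<close> between \<open>norm x / 2\<close> and \<open>norm x\<close>, and the integral of \<open>1 / t\<close>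
  over this interval is \<open>ln 2\<close> for every \<open>x\<close>.
\<close>

lemma nn_integral_polar_shell:
  fixes H :: "'a::euclidean_space \<Rightarrow> ennreal"
  assumes [measurable]: "H \<in> borel_measurable borel"
  shows "ennreal (ln 2) * (\<integral>\<^sup>+ x. H x \<partial>lborel)
    = (\<integral>\<^sup>+ y\<in>shell. (\<integral>\<^sup>+ t\<in>{0<..}. ennreal (t ^ (DIM('a) - 1)) * H (t *\<^sub>R y) \<partial>lborel) \<partial>lborel)"
proof -
  let ?n = "DIM('a)"
  have "(\<integral>\<^sup>+ y\<in>shell. (\<integral>\<^sup>+ t\<in>{0<..}. ennreal (t ^ (?n - 1)) * H (t *\<^sub>R y) \<partial>lborel) \<partial>lborel)
      = (\<integral>\<^sup>+ y. (\<integral>\<^sup>+ t. ennreal (t ^ (?n - 1)) * H (t *\<^sub>R y) * indicator {0<..} t * indicator shell y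
          \<partial>lborel) \<partial>(lborel :: 'a measure))"
    by (intro nn_integral_cong nn_integral_multc[symmetric]) measurable
  also have "\<dots> = (\<integral>\<^sup>+ t. (\<integral>\<^sup>+ y. ennreal (t ^ (?n - 1)) * H (t *\<^sub>R y) * indicator {0<..} t * indicator shell y
          \<partial>(lborel :: 'a measure)) \<partial>lborel)"
    by (intro lborel_pair.Fubini') measurable
  also have "\<dots> = (\<integral>\<^sup>+ t. (\<integral>\<^sup>+ x. H x * (ennreal (1 / t) * indicator {0<..} t * indicator shell (x /\<^sub>R t))
          \<partial>(lborel :: 'a measure)) \<partial>lborel)"
  proof (rule nn_integral_cong)
    fix t :: real
    show "(\<integral>\<^sup>+ y. ennreal (t ^ (?n - 1)) * H (t *\<^sub>R y) * indicator {0<..} t * indicator shell y \<partial>lborel)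
      = (\<integral>\<^sup>+ x. H x * (ennreal (1 / t) * indicator {0<..} t * indicator shell (x /\<^sub>R t)) \<partial>lborel)"
    proof (cases "0 < t")
      case t: True
      have "1 / t * t ^ ?n = t ^ (?n - 1)"
        using t by (simp add: power_eq_if)
      then have tn: "ennreal (1 / t) * ennreal (t ^ ?n) = ennreal (t ^ (?n - 1))"
        using t by (simp flip: ennreal_mult)
      have regroup: "ennreal (t ^ ?n) * (h * (ennreal (1 / t) * i)) = ennreal (t ^ (?n - 1)) * h * i"
        for h i :: ennreal
        unfolding tn[symmetric] by (simp only: mult_ac)
      have "(\<integral>\<^sup>+ x. H x * (ennreal (1 / t) * indicator {0<..} t * indicator shell (x /\<^sub>R t)) \<partial>lborel)
          = ennreal (t ^ ?n) * (\<integral>\<^sup>+ y. H (t *\<^sub>R y) * (ennreal (1 / t) * indicator shell y) \<partial>lborel)"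
        using t by (subst nn_integral_lborel_scaleR[OF t]) auto
      also have "\<dots> = (\<integral>\<^sup>+ y. ennreal (t ^ ?n) * (H (t *\<^sub>R y) * (ennreal (1 / t) * indicator shell y)) \<partial>lborel)"
        by (rule nn_integral_cmult[symmetric]) measurable
      also have "\<dots> = (\<integral>\<^sup>+ y. ennreal (t ^ (?n - 1)) * H (t *\<^sub>R y) * indicator {0<..} t * indicator shell y \<partial>lborel)"
        unfolding regroup using t by simp
      finally show ?thesis by simp
    qed simp
  qed
  also have "\<dots> = (\<integral>\<^sup>+ x. (\<integral>\<^sup>+ t. H x * (ennreal (1 / t) * indicator {0<..} t * indicator shell (x /\<^sub>R t))
          \<partial>lborel) \<partial>(lborel :: 'a measure))"
    by (intro lborel_pair.Fubini') measurable
  also have "\<dots> = (\<integral>\<^sup>+ x. H x * ennreal (ln 2) \<partial>(lborel :: 'a measure))"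
  proof (rule nn_integral_cong_AE)
    have "AE x in (lborel :: 'a measure). x \<noteq> 0" by (rule AE_lborel_singleton)
    then show "AE x in (lborel :: 'a measure).
      (\<integral>\<^sup>+ t. H x * (ennreal (1 / t) * indicator {0<..} t * indicator shell (x /\<^sub>R t)) \<partial>lborel) = H x * ennreal (ln 2)"
    proof eventually_elim
      case (elim x)
      have "(\<integral>\<^sup>+ t. H x * (ennreal (1 / t) * indicator {0<..} t * indicator shell (x /\<^sub>R t)) \<partial>lborel)
         = H x * (\<integral>\<^sup>+ t. ennreal (1 / t) * indicator {0<..} t * indicator shell (x /\<^sub>R t) \<partial>lborel)"
        by (rule nn_integral_cmult) measurable
      also have "(\<integral>\<^sup>+ t. ennreal (1 / t) * indicator {0<..} t * indicator shell (x /\<^sub>R t) \<partial>lborel)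
          = (\<integral>\<^sup>+ t\<in>{norm x / 2..norm x}. ennreal (1 / t) \<partial>lborel)"
      proof (rule nn_integral_cong)
        fix t :: real
        have "0 < t \<and> x /\<^sub>R t \<in> shell \<longleftrightarrow> t \<in> {norm x / 2..norm x}"
        proof (cases "0 < t")
          case True
          then show ?thesis by (auto simp: shell_def field_simps)
        next
          case False
          have "0 < norm x" using elim by simp
          then have "\<not> norm x / 2 \<le> t" using False by linarith
          then show ?thesis using False by simp
        qed
        then show "ennreal (1 / t) * indicator {0<..} t * indicator shell (x /\<^sub>R t)
            = ennreal (1 / t) * indicator {norm x / 2..norm x} t"
          by (auto simp: indicator_def)
      qed
      also have "\<dots> = ennreal (ln 2)" using elim by (intro nn_integral_inverse_dyadic) simp
      finally show ?case .
    qed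
  qed
  also have "\<dots> = ennreal (ln 2) * (\<integral>\<^sup>+ x. H x \<partial>lborel)"
    by (subst mult.commute) (rule nn_integral_cmult, measurable)
  finally show ?thesis by simp
qed

text \<open>
  The same formula for the Gaussian measure, with each ray parametrised by arc length
  \<open>s = t * norm y\<close>, so that the radial measure no longer depends on \<open>y\<close>.
\<close>

lemma nn_integral_gam_polar:
  fixes G :: "real ^ 'n::finite \<Rightarrow> ennreal"
  assumes [measurable]: "G \<in> borel_measurable borel"
  shows "ennreal (ln 2) * (\<integral>\<^sup>+ x. G x \<partial>gam)
    = (\<integral>\<^sup>+ y\<in>shell. (ennreal (1 / norm y ^ CARD('n)) *
        (\<integral>\<^sup>+ s\<in>{0..}. G ((s / norm y) *\<^sub>R y) \<partial>mu CARD('n))) \<partial>lborel)"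
proof -
  let ?n = "CARD('n)"
  define E where "E r = ennreal (exp (- r\<^sup>2 / 2))" for r :: real
  have [measurable]: "E \<in> borel_measurable borel" unfolding E_def by measurable
  have "(\<integral>\<^sup>+ x. G x \<partial>gam) = (\<integral>\<^sup>+ x. E (norm x) * G x \<partial>lborel)"
    unfolding gam_def E_def by (subst nn_integral_density) simp_all
  then have "ennreal (ln 2) * (\<integral>\<^sup>+ x. G x \<partial>gam) = (\<integral>\<^sup>+ y\<in>shell.
      (\<integral>\<^sup>+ t\<in>{0<..}. ennreal (t ^ (?n - 1)) * (E (norm (t *\<^sub>R y)) * G (t *\<^sub>R y)) \<partial>lborel) \<partial>lborel)"
    using nn_integral_polar_shell[of "\<lambda>x. E (norm x) * G x"] by simp
  also have "\<dots> = (\<integral>\<^sup>+ y\<in>shell. (ennreal (1 / norm y ^ ?n) *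
        (\<integral>\<^sup>+ s\<in>{0..}. G ((s / norm y) *\<^sub>R y) \<partial>mu ?n)) \<partial>lborel)"
  proof (rule nn_integral_cong)
    fix y :: "real ^ 'n"
    show "(\<integral>\<^sup>+ t\<in>{0<..}. ennreal (t ^ (?n - 1)) * (E (norm (t *\<^sub>R y)) * G (t *\<^sub>R y)) \<partial>lborel) * indicator shell y
      = ennreal (1 / norm y ^ ?n) * (\<integral>\<^sup>+ s\<in>{0..}. G ((s / norm y) *\<^sub>R y) \<partial>mu ?n) * indicator shell y"
    proof (cases "y \<in> shell")
      case True
      define \<rho> where "\<rho> = norm y"
      have "1 \<le> norm y" using True by (simp add: shell_def)
      then have \<rho>: "0 < \<rho>" unfolding \<rho>_def by linarith
      have n': "\<rho> ^ ?n = \<rho> * \<rho> ^ (?n - 1)" by (subst power_eq_if) simp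
      have "(\<integral>\<^sup>+ t\<in>{0<..}. ennreal (t ^ (?n - 1)) * (E (norm (t *\<^sub>R y)) * G (t *\<^sub>R y)) \<partial>lborel)
          = ennreal \<bar>1 / \<rho>\<bar> * (\<integral>\<^sup>+ s. ennreal ((0 + 1 / \<rho> * s) ^ (?n - 1)) *
              (E (norm ((0 + 1 / \<rho> * s) *\<^sub>R y)) * G ((0 + 1 / \<rho> * s) *\<^sub>R y)) * indicator {0<..} (0 + 1 / \<rho> * s) \<partial>lborel)"
        using \<rho> by (intro nn_integral_real_affine) (measurable, auto intro!: open_Collect_less)
      also have "\<dots> = (\<integral>\<^sup>+ s. ennreal \<bar>1 / \<rho>\<bar> * (ennreal ((0 + 1 / \<rho> * s) ^ (?n - 1)) *
              (E (norm ((0 + 1 / \<rho> * s) *\<^sub>R y)) * G ((0 + 1 / \<rho> * s) *\<^sub>R y)) * indicator {0<..} (0 + 1 / \<rho> * s)) \<partial>lborel)"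
        by (rule nn_integral_cmult[symmetric]) measurable
      also have "\<dots> = (\<integral>\<^sup>+ s. ennreal (1 / \<rho> ^ ?n) * (ennreal (indicator {0..} s * s ^ (?n - 1) * exp (- s\<^sup>2 / 2)) *
              (G ((s / \<rho>) *\<^sub>R y) * indicator {0..} s)) \<partial>lborel)"
      proof (rule nn_integral_cong_AE)
        have "AE s in lborel. s \<noteq> (0::real)" by (rule AE_lborel_singleton)
        then show "AE s in lborel. ennreal \<bar>1 / \<rho>\<bar> * (ennreal ((0 + 1 / \<rho> * s) ^ (?n - 1)) *
              (E (norm ((0 + 1 / \<rho> * s) *\<^sub>R y)) * G ((0 + 1 / \<rho> * s) *\<^sub>R y)) * indicator {0<..} (0 + 1 / \<rho> * s))
            = ennreal (1 / \<rho> ^ ?n) * (ennreal (indicator {0..} s * s ^ (?n - 1) * exp (- s\<^sup>2 / 2)) *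
              (G ((s / \<rho>) *\<^sub>R y) * indicator {0..} s))"
        proof eventually_elim
          case (elim s)
          show ?case
          proof (cases "0 < s")
            case s: True
            have "norm ((s / \<rho>) *\<^sub>R y) = s" using \<rho> s by (simp add: \<rho>_def)
            moreover have "1 / \<rho> * (s / \<rho>) ^ (?n - 1) = 1 / \<rho> ^ ?n * s ^ (?n - 1)"
              using \<rho> by (simp add: power_divide n')
            then have "ennreal (1 / \<rho>) * ennreal ((s / \<rho>) ^ (?n - 1)) = ennreal (1 / \<rho> ^ ?n) * ennreal (s ^ (?n - 1))"
              using s \<rho> by (simp flip: ennreal_mult)
            ultimately show ?thesis using s \<rho>
              by (simp add: E_def ennreal_mult mult.assoc[symmetric])
          next
            case False
            then have "s < 0" using elim by simp
            then have "s / \<rho> < 0" using \<rho> by (simp add: divide_less_0_iff)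
            then show ?thesis using \<open>s < 0\<close> by (simp add: indicator_def)
          qed
        qed
      qed
      also have "\<dots> = ennreal (1 / \<rho> ^ ?n) * (\<integral>\<^sup>+ s. ennreal (indicator {0..} s * s ^ (?n - 1) * exp (- s\<^sup>2 / 2)) *
              (G ((s / \<rho>) *\<^sub>R y) * indicator {0..} s) \<partial>lborel)"
        by (rule nn_integral_cmult) measurable
      also have "\<dots> = ennreal (1 / \<rho> ^ ?n) * (\<integral>\<^sup>+ s\<in>{0..}. G ((s / \<rho>) *\<^sub>R y) \<partial>mu ?n)"
        unfolding mu_def by (subst nn_integral_density) simp_all
      finally show ?thesis by (simp add: \<rho>_def)
    qed simp
  qed
  finally show ?thesis .
qed

section \<open>The Gaussian inequality in space\<close>

lemma C1_compact_supportD: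
  assumes "C1_compact_support u"
  shows "GDERIV u x :> gradient u x" and "continuous_on UNIV u"
    and "continuous_on UNIV (gradient u)"
proof -
  have d: "GDERIV u x :> gradient u x" for x
    using assms gradient_eqI unfolding C1_compact_support_def by metis
  then show "GDERIV u x :> gradient u x" .
  show "continuous_on UNIV u"
    using d unfolding gderiv_def
    by (auto intro!: continuous_at_imp_continuous_on has_derivative_continuous)
  show "continuous_on UNIV (gradient u)" using assms by (simp add: C1_compact_support_def)
qed

lemma ray_restriction_deriv:
  fixes u :: "'a::euclidean_space \<Rightarrow> real"
  assumes "C1_compact_support u" and "\<rho> \<noteq> 0"
  shows "((\<lambda>s. u ((s / \<rho>) *\<^sub>R y)) has_real_derivative
           (y \<bullet> gradient u ((s / \<rho>) *\<^sub>R y)) / \<rho>) (at s)"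
proof -
  have "((\<lambda>s. (s / \<rho>) *\<^sub>R y) has_derivative (\<lambda>h. (h / \<rho>) *\<^sub>R y)) (at s)"
    using assms(2) by (auto intro!: derivative_eq_intros simp: field_simps)
  then have "((\<lambda>s. u ((s / \<rho>) *\<^sub>R y)) has_derivative
      (\<lambda>h. ((h / \<rho>) *\<^sub>R y) \<bullet> gradient u ((s / \<rho>) *\<^sub>R y))) (at s)"
    using C1_compact_supportD(1)[OF assms(1)] unfolding gderiv_def
    by (rule has_derivative_compose)
  then show ?thesis
    unfolding has_field_derivative_def by (rule has_derivative_eq_rhs) (auto simp: fun_eq_iff)
qed

lemma ray_restriction_piecewise_C1:
  fixes u :: "'a::euclidean_space \<Rightarrow> real"
  assumes "C1_compact_support u" and "\<rho> \<noteq> 0"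
  shows "piecewise_C1_halfline (\<lambda>s. u ((s / \<rho>) *\<^sub>R y))"
  unfolding piecewise_C1_halfline_def
proof (intro allI impI C1_differentiable_imp_piecewise)
  fix R :: real
  have "continuous_on {0..R} (\<lambda>s. (y \<bullet> gradient u ((s / \<rho>) *\<^sub>R y)) * inverse \<rho>)"
    by (intro continuous_intros continuous_on_compose2[OF C1_compact_supportD(3)[OF assms(1)]])
       (use assms(2) in auto)
  moreover have "((\<lambda>s. u ((s / \<rho>) *\<^sub>R y)) has_vector_derivative
      (y \<bullet> gradient u ((s / \<rho>) *\<^sub>R y)) * inverse \<rho>) (at s)" for s
    using ray_restriction_deriv[OF assms, of y s]
    by (simp only: has_real_derivative_iff_has_vector_derivative
        divide_inverse[of "y \<bullet> gradient u ((s / \<rho>) *\<^sub>R y)"])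
  ultimately show "(\<lambda>s. u ((s / \<rho>) *\<^sub>R y)) C1_differentiable_on {0..R}"
    unfolding C1_differentiable_on_def
    by (intro exI[of _ "\<lambda>s. (y \<bullet> gradient u ((s / \<rho>) *\<^sub>R y)) * inverse \<rho>"] conjI ballI)
qed

text \<open>
  The right-hand side is written as a single Gaussian integral of a function \<open>F\<close>, so that
  \<open>nn_integral_gam_polar\<close> reduces the claim to the comparison of two integrals along each ray.  That
  comparison is \<open>halfline_inequality\<close> for the restriction of \<open>u\<close> to the ray.
\<close>

lemma gaussian_inequality:
  fixes u :: "real ^ 'n::finite \<Rightarrow> real"
  assumes g: "growth_convex D M" and D: "0 < D" and u: "C1_compact_support u"
  shows "(\<integral>\<^sup>+ x. ennreal (M (norm x * \<bar>u x\<bar>)) \<partial>gam)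
    \<le> ennreal (ray_const1 CARD('n) D * 2 powr D) * (\<integral>\<^sup>+ x. ennreal (M \<bar>u x\<bar>) \<partial>gam)
      + ennreal (ray_const2 D) * (\<integral>\<^sup>+ x. ennreal (M (norm (gradient u x))) \<partial>gam)"
proof -
  define c1 c2 where "c1 = ennreal (ray_const1 CARD('n) D * 2 powr D)" and "c2 = ennreal (ray_const2 D)"
  have [measurable]: "u \<in> borel_measurable borel" "gradient u \<in> borel_measurable borel"
    using C1_compact_supportD(2,3)[OF u] by (auto intro: borel_measurable_continuous_onI)
  have [measurable]: "(\<lambda>x. M (norm x * \<bar>u x\<bar>)) \<in> borel_measurable borel"
    "(\<lambda>x. M \<bar>u x\<bar>) \<in> borel_measurable borel"
    "(\<lambda>x. M (norm (gradient u x))) \<in> borel_measurable borel"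
    by (intro growth_convex_measurable[OF g]; simp)+
  have sets_mu [measurable_cong]: "sets (mu m) = sets borel" for m by (simp add: mu_def)
  have sets_gam [measurable_cong]: "sets gam = sets borel" by (simp add: gam_def)
  define F where "F x = c1 * ennreal (M \<bar>u x\<bar>) + c2 * ennreal (M (norm (gradient u x)))" for x
  have [measurable]: "F \<in> borel_measurable borel" unfolding F_def by measurable
  have ray: "(\<integral>\<^sup>+ s\<in>{0..}. ennreal (M (norm ((s / norm y) *\<^sub>R y) * \<bar>u ((s / norm y) *\<^sub>R y)\<bar>)) \<partial>mu CARD('n))
      \<le> (\<integral>\<^sup>+ s\<in>{0..}. F ((s / norm y) *\<^sub>R y) \<partial>mu CARD('n))" if "y \<in> shell" for y
  proof -
    define v where "v s = u ((s / norm y) *\<^sub>R y)" for s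
    have "1 \<le> norm y" using that by (simp add: shell_def)
    then have y: "0 < norm y" by linarith
    have dv: "\<bar>deriv v s\<bar> \<le> norm (gradient u ((s / norm y) *\<^sub>R y))" for s
    proof -
      have "deriv v s = (y \<bullet> gradient u ((s / norm y) *\<^sub>R y)) / norm y"
        unfolding v_def by (intro DERIV_imp_deriv ray_restriction_deriv u) (use y in simp)
      then show ?thesis
        using Cauchy_Schwarz_ineq2[of y "gradient u ((s / norm y) *\<^sub>R y)"] y
        by (simp add: abs_divide pos_divide_le_eq mult.commute)
    qed
    have "(\<integral>\<^sup>+ s\<in>{0..}. ennreal (M (norm ((s / norm y) *\<^sub>R y) * \<bar>u ((s / norm y) *\<^sub>R y)\<bar>)) \<partial>mu CARD('n))
        = (\<integral>\<^sup>+ s\<in>{0..}. ennreal (M (s * \<bar>v s\<bar>)) \<partial>mu CARD('n))"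
      using y by (intro nn_integral_cong) (auto simp: v_def indicator_def)
    also have "\<dots> \<le> c1 * (\<integral>\<^sup>+ s\<in>{0..}. ennreal (M \<bar>v s\<bar>) \<partial>mu CARD('n))
        + c2 * (\<integral>\<^sup>+ s\<in>{0..}. ennreal (M \<bar>deriv v s\<bar>) \<partial>mu CARD('n))"
      unfolding c1_def c2_def v_def
      by (intro halfline_inequality[OF g D] ray_restriction_piecewise_C1 u) (use y in simp_all)
    also have "\<dots> \<le> c1 * (\<integral>\<^sup>+ s\<in>{0..}. ennreal (M \<bar>v s\<bar>) \<partial>mu CARD('n))
        + c2 * (\<integral>\<^sup>+ s\<in>{0..}. ennreal (M (norm (gradient u ((s / norm y) *\<^sub>R y)))) \<partial>mu CARD('n))"
      by (intro add_left_mono mult_left_mono nn_integral_mono mult_right_mono ennreal_leI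
          growth_convex_mono[OF g] dv) auto
    also have "\<dots> = (\<integral>\<^sup>+ s. c1 * (ennreal (M \<bar>v s\<bar>) * indicator {0..} s)
          + c2 * (ennreal (M (norm (gradient u ((s / norm y) *\<^sub>R y)))) * indicator {0..} s) \<partial>mu CARD('n))"
      unfolding v_def by (subst nn_integral_add) (simp_all add: nn_integral_cmult)
    also have "\<dots> = (\<integral>\<^sup>+ s\<in>{0..}. F ((s / norm y) *\<^sub>R y) \<partial>mu CARD('n))"
      by (intro nn_integral_cong) (simp add: F_def v_def distrib_right mult.assoc)
    finally show ?thesis .
  qed
  have "ennreal (ln 2) * (\<integral>\<^sup>+ x. ennreal (M (norm x * \<bar>u x\<bar>)) \<partial>gam)
      \<le> ennreal (ln 2) * (\<integral>\<^sup>+ x. F x \<partial>gam)"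
    unfolding nn_integral_gam_polar[OF \<open>F \<in> borel_measurable borel\<close>]
  proof (subst nn_integral_gam_polar)
    show "(\<lambda>x. ennreal (M (norm x * \<bar>u x\<bar>))) \<in> borel_measurable borel" by measurable
  qed (rule nn_integral_mono, use ray in \<open>auto intro!: mult_left_mono simp: indicator_def\<close>)
  then have "(\<integral>\<^sup>+ x. ennreal (M (norm x * \<bar>u x\<bar>)) \<partial>gam) \<le> (\<integral>\<^sup>+ x. F x \<partial>gam)"
    by (subst (asm) ennreal_mult_le_mult_iff) auto
  also have "(\<integral>\<^sup>+ x. F x \<partial>gam) = c1 * (\<integral>\<^sup>+ x. ennreal (M \<bar>u x\<bar>) \<partial>gam)
      + c2 * (\<integral>\<^sup>+ x. ennreal (M (norm (gradient u x))) \<partial>gam)"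
    unfolding F_def by (subst nn_integral_add) (simp_all add: nn_integral_cmult)
  finally show ?thesis unfolding c1_def c2_def .
qed

section \<open>Luxemburg norms\<close>

lemma C1_compact_support_scale:
  assumes "C1_compact_support u" "K \<noteq> 0"
  shows "C1_compact_support (\<lambda>x. u x / K)"
    and "gradient (\<lambda>x. u x / K) x = gradient u x /\<^sub>R K"
proof -
  have d: "GDERIV (\<lambda>x. u x / K) x :> gradient u x /\<^sub>R K" for x
    using has_derivative_mult_left[OF C1_compact_supportD(1)[OF assms(1), of x, unfolded gderiv_def], of "inverse K"]
    by (simp add: gderiv_def divide_inverse mult.commute)
  then show grad: "gradient (\<lambda>x. u x / K) x = gradient u x /\<^sub>R K" for x by (rule gradient_eqI)
  have "{x. u x / K \<noteq> 0} = {x. u x \<noteq> 0}" using assms(2) by auto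
  then show "C1_compact_support (\<lambda>x. u x / K)"
    using assms(1) d unfolding C1_compact_support_def grad[abs_def]
    by (auto intro!: continuous_intros)
qed

lemma le_mult_add_INF_ennreal:
  fixes X :: ennreal and C :: real
  assumes C: "0 < C" and le: "\<And>a b. a \<in> A \<Longrightarrow> b \<in> B \<Longrightarrow> X \<le> ennreal C * (f a + g b)"
  shows "X \<le> ennreal C * ((INF a\<in>A. f a) + (INF b\<in>B. g b))"
proof (rule ennreal_le_epsilon)
  let ?I = "INF a\<in>A. f a" and ?J = "INF b\<in>B. g b"
  fix e :: real assume fin: "ennreal C * (?I + ?J) < top" and e: "0 < e"
  define d where "d = e / (2 * C)"
  have d: "0 < ennreal d" using C e by (simp add: d_def)
  have "?I < top" "?J < top" using fin C by (auto simp: ennreal_mult_less_top)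
  moreover have "x < x + ennreal d" if "x < top" for x
    using that d ennreal_add_left_cancel_less[of x 0 "ennreal d"] by simp
  ultimately have "?I < ?I + ennreal d" "?J < ?J + ennreal d" by blast+
  then obtain a b where "a \<in> A" "f a < ?I + ennreal d" "b \<in> B" "g b < ?J + ennreal d"
    by (metis INF_less_iff)
  then have "X \<le> ennreal C * ((?I + ennreal d) + (?J + ennreal d))"
    by (intro order_trans[OF le] mult_left_mono add_mono) auto
  also have "\<dots> = ennreal C * (?I + ?J) + ennreal C * (ennreal d + ennreal d)"
    by (simp add: algebra_simps)
  also have "ennreal C * (ennreal d + ennreal d) = ennreal e"
    using C e by (simp add: d_def flip: ennreal_plus ennreal_mult)
  finally show "X \<le> ennreal C * (?I + ?J) + ennreal e" .
qed

text \<open>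
  For admissible \<open>a\<close> and \<open>b\<close> the sum \<open>K = a + b\<close> is admissible for both \<open>u\<close> and its gradient, so the
  modular inequality for \<open>u / K\<close> has right-hand side at most \<open>c1 + c2\<close>.  Dividing the argument of
  \<open>M\<close> further by \<open>1 + c1 + c2\<close> divides the modular by at least as much, which brings it below \<open>1\<close>.
\<close>

lemma luxemburg_norm_inequality:
  fixes c1 c2 :: real and u :: "real ^ 'n::finite \<Rightarrow> real"
  assumes g: "growth_convex D M" and c: "0 \<le> c1" "0 \<le> c2"
    and modular: "\<And>w :: real ^ 'n \<Rightarrow> real. C1_compact_support w \<Longrightarrow>
      (\<integral>\<^sup>+ x. ennreal (M (norm x * \<bar>w x\<bar>)) \<partial>gam)
        \<le> ennreal c1 * (\<integral>\<^sup>+ x. ennreal (M \<bar>w x\<bar>) \<partial>gam)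
          + ennreal c2 * (\<integral>\<^sup>+ x. ennreal (M (norm (gradient w x))) \<partial>gam)"
    and u: "C1_compact_support u"
  shows "luxemburg_norm M gam (\<lambda>x. u x *\<^sub>R x)
    \<le> ennreal (1 + c1 + c2) * (luxemburg_norm M gam u + luxemburg_norm M gam (gradient u))"
  unfolding luxemburg_norm_def[of M gam u] luxemburg_norm_def[of M gam "gradient u"]
proof (rule le_mult_add_INF_ennreal)
  let ?C = "1 + c1 + c2"
  fix a b :: real
  assume "a \<in> {K. 0 < K \<and> (\<integral>\<^sup>+ x. ennreal (M (norm (u x) / K)) \<partial>gam) \<le> 1}"
    and "b \<in> {K. 0 < K \<and> (\<integral>\<^sup>+ x. ennreal (M (norm (gradient u x) / K)) \<partial>gam) \<le> 1}"
  then have a: "0 < a" "(\<integral>\<^sup>+ x. ennreal (M (\<bar>u x\<bar> / a)) \<partial>gam) \<le> 1"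
    and b: "0 < b" "(\<integral>\<^sup>+ x. ennreal (M (norm (gradient u x) / b)) \<partial>gam) \<le> 1" by auto
  define K where "K = a + b"
  have K: "0 < K" "a \<le> K" "b \<le> K" using a b by (auto simp: K_def)
  define w where "w x = u x / K" for x
  have w: "C1_compact_support w" and grad: "gradient w x = gradient u x /\<^sub>R K" for x
    using C1_compact_support_scale[OF u, of K] K unfolding w_def by auto
  have "(\<integral>\<^sup>+ x. ennreal (M \<bar>w x\<bar>) \<partial>gam) \<le> (\<integral>\<^sup>+ x. ennreal (M (\<bar>u x\<bar> / a)) \<partial>gam)"
    using a K by (intro nn_integral_mono ennreal_leI growth_convex_mono[OF g])
       (auto simp: w_def intro!: divide_left_mono)
  with a have 1: "(\<integral>\<^sup>+ x. ennreal (M \<bar>w x\<bar>) \<partial>gam) \<le> 1" by simp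
  have "(\<integral>\<^sup>+ x. ennreal (M (norm (gradient w x))) \<partial>gam) \<le> (\<integral>\<^sup>+ x. ennreal (M (norm (gradient u x) / b)) \<partial>gam)"
    using b K by (intro nn_integral_mono ennreal_leI growth_convex_mono[OF g])
       (auto simp: grad divide_inverse_commute intro!: mult_right_mono)
  with b have 2: "(\<integral>\<^sup>+ x. ennreal (M (norm (gradient w x))) \<partial>gam) \<le> 1" by simp
  have "u \<in> borel_measurable borel"
    using C1_compact_supportD(2)[OF u] by (auto intro: borel_measurable_continuous_onI)
  then have meas: "(\<lambda>x. M (norm x * \<bar>w x\<bar>)) \<in> borel_measurable gam"
    unfolding w_def gam_def by (intro growth_convex_measurable[OF g]) auto
  have "(\<integral>\<^sup>+ x. ennreal (M (norm (u x *\<^sub>R x) / (?C * K))) \<partial>gam)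
      \<le> (\<integral>\<^sup>+ x. ennreal (1 / ?C) * ennreal (M (norm x * \<bar>w x\<bar>)) \<partial>gam)"
  proof (rule nn_integral_mono)
    fix x :: "real ^ 'n"
    have "norm (u x *\<^sub>R x) / (?C * K) = 1 / ?C * (norm x * \<bar>w x\<bar>)"
      using K by (simp add: w_def)
    then have "M (norm (u x *\<^sub>R x) / (?C * K)) \<le> 1 / ?C * M (norm x * \<bar>w x\<bar>)"
      using c by (simp only:) (rule growth_convex_scale_down[OF g]; simp)
    then show "ennreal (M (norm (u x *\<^sub>R x) / (?C * K))) \<le> ennreal (1 / ?C) * ennreal (M (norm x * \<bar>w x\<bar>))"
      using c growth_convex_nonneg[OF g, of "norm x * \<bar>w x\<bar>"]
      by (subst ennreal_mult[symmetric]) (auto intro!: ennreal_leI)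
  qed
  also have "\<dots> = ennreal (1 / ?C) * (\<integral>\<^sup>+ x. ennreal (M (norm x * \<bar>w x\<bar>)) \<partial>gam)"
    using meas by (intro nn_integral_cmult) auto
  also have "\<dots> \<le> ennreal (1 / ?C) * (ennreal c1 * 1 + ennreal c2 * 1)"
    by (intro mult_left_mono order_trans[OF modular[OF w]] add_mono 1 2) auto
  also have "\<dots> = ennreal ((c1 + c2) / ?C)"
    using c by (simp flip: ennreal_plus ennreal_mult)
  also have "\<dots> \<le> 1" using c by simp
  finally have "luxemburg_norm M gam (\<lambda>x. u x *\<^sub>R x) \<le> ennreal (?C * K)"
    unfolding luxemburg_norm_def using c K by (intro INF_lower) auto
  also have "\<dots> = ennreal ?C * (ennreal a + ennreal b)"
    using c a b by (simp add: K_def ennreal_mult)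
  finally show "luxemburg_norm M gam (\<lambda>x. u x *\<^sub>R x) \<le> ennreal ?C * (ennreal a + ennreal b)" .
qed (use c in auto)

theorem theorem3p1:
  fixes D :: real
  assumes "D > 0"
  shows "\<exists>C1 C2 :: real. C1 \<ge> 0 \<and> C2 \<ge> 0 \<and>
    (\<forall>M. growth_convex D M \<longrightarrow>
       (\<forall>v. piecewise_C1_halfline v \<longrightarrow>
          (\<integral>\<^sup>+ r\<in>{0..}. ennreal (M (r * \<bar>v r\<bar>)) \<partial>mu CARD('n))
            \<le> ennreal C1 * (\<integral>\<^sup>+ r\<in>{0..}. ennreal (M \<bar>v r\<bar>) \<partial>mu CARD('n))
              + ennreal C2 * (\<integral>\<^sup>+ r\<in>{0..}. ennreal (M \<bar>deriv v r\<bar>) \<partial>mu CARD('n))) \<and>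
       (\<forall>u :: real ^ 'n::finite \<Rightarrow> real. C1_compact_support u \<longrightarrow>
          (\<integral>\<^sup>+ x. ennreal (M (norm x * \<bar>u x\<bar>)) \<partial>gam)
            \<le> ennreal C1 * (\<integral>\<^sup>+ x. ennreal (M \<bar>u x\<bar>) \<partial>gam)
              + ennreal C2 * (\<integral>\<^sup>+ x. ennreal (M (norm (gradient u x))) \<partial>gam)) \<and>
       (N_function M \<longrightarrow>
          (\<exists>C>0. \<forall>u :: real ^ 'n \<Rightarrow> real. C1_compact_support u \<longrightarrow>
             luxemburg_norm M gam (\<lambda>x. u x *\<^sub>R x)
               \<le> ennreal C * (luxemburg_norm M gam u + luxemburg_norm M gam (gradient u)))))"
proof -
  define C1 C2 where "C1 = ray_const1 CARD('n) D * 2 powr D" and "C2 = ray_const2 D"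
  have C: "0 \<le> C1" "0 \<le> C2"
    using ray_const1_nonneg ray_const2_pos[of D] by (auto simp: C1_def C2_def)
  have n: "1 \<le> CARD('n)" by simp
  show ?thesis
  proof (rule exI[of _ C1], rule exI[of _ C2], intro conjI allI impI)
    fix M assume M: "growth_convex D M"
    show "(\<integral>\<^sup>+ r\<in>{0..}. ennreal (M (r * \<bar>v r\<bar>)) \<partial>mu CARD('n))
        \<le> ennreal C1 * (\<integral>\<^sup>+ r\<in>{0..}. ennreal (M \<bar>v r\<bar>) \<partial>mu CARD('n))
          + ennreal C2 * (\<integral>\<^sup>+ r\<in>{0..}. ennreal (M \<bar>deriv v r\<bar>) \<partial>mu CARD('n))"
      if "piecewise_C1_halfline v" for v
      unfolding C1_def C2_def using that by (rule halfline_inequality[OF M assms n])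
    have modular: "(\<integral>\<^sup>+ x. ennreal (M (norm x * \<bar>u x\<bar>)) \<partial>gam)
        \<le> ennreal C1 * (\<integral>\<^sup>+ x. ennreal (M \<bar>u x\<bar>) \<partial>gam)
          + ennreal C2 * (\<integral>\<^sup>+ x. ennreal (M (norm (gradient u x))) \<partial>gam)"
      if "C1_compact_support u" for u :: "real ^ 'n \<Rightarrow> real"
      unfolding C1_def C2_def using that by (rule gaussian_inequality[OF M assms])
    then show "(\<integral>\<^sup>+ x. ennreal (M (norm x * \<bar>u x\<bar>)) \<partial>gam)
        \<le> ennreal C1 * (\<integral>\<^sup>+ x. ennreal (M \<bar>u x\<bar>) \<partial>gam)
          + ennreal C2 * (\<integral>\<^sup>+ x. ennreal (M (norm (gradient u x))) \<partial>gam)"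
      if "C1_compact_support u" for u :: "real ^ 'n \<Rightarrow> real"
      using that .
    show "\<exists>C>0. \<forall>u :: real ^ 'n \<Rightarrow> real. C1_compact_support u \<longrightarrow>
        luxemburg_norm M gam (\<lambda>x. u x *\<^sub>R x)
          \<le> ennreal C * (luxemburg_norm M gam u + luxemburg_norm M gam (gradient u))"
      using luxemburg_norm_inequality[OF M C modular] C
      by (intro exI[of _ "1 + C1 + C2"]) auto
  qed (use C in auto)
qed

end
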